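(* Let $(\rho(\theta))_{\theta\in\mathbb{R}^L}$ be a parameterized family of second-order differentiable, positive definite states on a finite-dimensional Hilbert space. For all $\alpha\in(0,1)\cup(1,\infty)$ and $z>0$, the $\alpha$-$z$ information matrix satisfies $$[I_{\alpha,z}(\theta)]_{i,j}=\sum_{k,\ell}\zeta_{\alpha,z}(\lambda_k,\lambda_\ell)\,\mathrm{Tr}\left[\Pi_k(\partial_i\rho(\theta))\Pi_\ell(\partial_j\rho(\theta))\right],$$ where $\partial_i=\frac{\partial}{\partial\theta_i}$, the spectral decomposition of $\rho(\theta)$ is $\rho(\theta)=\sum_k\lambda_k\Pi_k$, and for all $x,y>0$, $$\zeta_{\alpha,z}(x,y):=\begin{cases}\frac{z}{\alpha(1-\alpha)}\left(\frac{x^{\frac{1-\alpha}{z}}-y^{\frac{1-\alpha}{z}}}{x-y}\right)\left(\frac{x^{\frac{\alpha}{z}}-y^{\frac{\alpha}{z}}}{x^{\frac1z}-y^{\frac1z}}\right)& :x\ne y\\ \frac1x& :x=y.\end{cases}$$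
   Context: A state is a positive semi-definite operator of unit trace. For positive definite states $\rho,\sigma$, $\alpha\in(0,1)\cup(1,\infty)$ and $z>0$, the $\alpha$-$z$ Rényi relative entropy is $D_{\alpha,z}(\rho\|\sigma):=\frac{1}{\alpha-1}\ln\mathrm{Tr}\big[(\sigma^{\frac{1-\alpha}{2z}}\rho^{\frac\alpha z}\sigma^{\frac{1-\alpha}{2z}})^z\big]=\frac{1}{\alpha-1}\ln\mathrm{Tr}\big[(\rho^{\frac{\alpha}{2z}}\sigma^{\frac{1-\alpha}z}\rho^{\frac{\alpha}{2z}})^z\big]$. The $\alpha$-$z$ information matrix has entries $[I_{\alpha,z}(\theta)]_{i,j}:=\frac1\alpha\left.\frac{\partial^2}{\partial\varepsilon_i\partial\varepsilon_j}D_{\alpha,z}(\rho(\theta)\|\rho(\theta+\varepsilon))\right|_{\varepsilon=0}$. In the spectral decomposition, $\lambda_k$ are the eigenvalues and $\Pi_k$ the corresponding eigenprojections of $\rho(\theta)$ (dependence on $\theta$ suppressed). *)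

theory Defs
  imports "HOL-Analysis.Analysis"
begin

definition hermitian :: "complex ^ 'n ^ 'n \<Rightarrow> bool"
  where "hermitian A \<longleftrightarrow> (\<forall>i j. A $ i $ j = cnj (A $ j $ i))"

(* The library inner product on complex ^ 'n is the real part of the Hermitian one;
   for Hermitian A the Hermitian form of A is real, so nothing is lost. *)
definition pos_semidef :: "complex ^ 'n ^ 'n \<Rightarrow> bool"
  where "pos_semidef A \<longleftrightarrow> hermitian A \<and> (\<forall>x. 0 \<le> x \<bullet> (A *v x))"

definition pos_def :: "complex ^ 'n ^ 'n \<Rightarrow> bool"
  where "pos_def A \<longleftrightarrow> hermitian A \<and> (\<forall>x. x \<noteq> 0 \<longrightarrow> 0 < x \<bullet> (A *v x))"

definition state :: "complex ^ 'n ^ 'n \<Rightarrow> bool"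
  where "state A \<longleftrightarrow> pos_semidef A \<and> trace A = 1"

(* Only real eigenvalues are collected; this is the whole spectrum when A is Hermitian. *)
definition eigenvalues :: "complex ^ 'n ^ 'n \<Rightarrow> real set"
  where "eigenvalues A = {c. \<exists>x. x \<noteq> 0 \<and> A *v x = c *\<^sub>R x}"

(* The orthogonal projection onto the eigenspace of A for c. *)
definition eigenprojection :: "complex ^ 'n ^ 'n \<Rightarrow> real \<Rightarrow> complex ^ 'n ^ 'n"
  where "eigenprojection A c =
    (THE P. hermitian P \<and> P ** P = P \<and> range ((*v) P) = {x. A *v x = c *\<^sub>R x})"

(* Functional calculus for t \<mapsto> t powr p; meant for positive definite A. *)
definition op_powr :: "complex ^ 'n ^ 'n \<Rightarrow> real \<Rightarrow> complex ^ 'n ^ 'n"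
  where "op_powr A p = (\<Sum>c\<in>eigenvalues A. (c powr p) *\<^sub>R eigenprojection A c)"

(* For positive definite arguments the trace is a positive real number,
   so Re only changes its type. *)
definition renyi_div ::
    "real \<Rightarrow> real \<Rightarrow> complex ^ 'n ^ 'n \<Rightarrow> complex ^ 'n ^ 'n \<Rightarrow> real"
  where "renyi_div \<alpha> z \<rho> \<sigma> =
    1 / (\<alpha> - 1) *
      ln (Re (trace (op_powr
        (op_powr \<sigma> ((1 - \<alpha>) / (2 * z)) ** op_powr \<rho> (\<alpha> / z) ** op_powr \<sigma> ((1 - \<alpha>) / (2 * z)))
        z)))"

definition partial_deriv ::
    "'l \<Rightarrow> (real ^ 'l \<Rightarrow> 'b::real_normed_vector) \<Rightarrow> real ^ 'l \<Rightarrow> 'b"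
  where "partial_deriv i f x = vector_derivative (\<lambda>t. f (x + t *\<^sub>R axis i 1)) (at 0)"

definition twice_differentiable ::
    "('a::real_normed_vector \<Rightarrow> 'b::real_normed_vector) \<Rightarrow> bool"
  where "twice_differentiable f \<longleftrightarrow>
    (\<exists>f' :: 'a \<Rightarrow> 'a \<Rightarrow>\<^sub>L 'b.
      (\<forall>x. (f has_derivative blinfun_apply (f' x)) (at x)) \<and> (\<forall>x. f' differentiable (at x)))"

definition info_matrix ::
    "real \<Rightarrow> real \<Rightarrow> (real ^ 'l \<Rightarrow> complex ^ 'n ^ 'n) \<Rightarrow> real ^ 'l \<Rightarrow> real ^ 'l ^ 'l"
  where "info_matrix \<alpha> z \<rho> \<theta> =
    (\<chi> i j. 1 / \<alpha> *
      partial_deriv i (partial_deriv j (\<lambda>\<epsilon>. renyi_div \<alpha> z (\<rho> \<theta>) (\<rho> (\<theta> + \<epsilon>)))) 0)"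

definition zeta_fun :: "real \<Rightarrow> real \<Rightarrow> real \<Rightarrow> real \<Rightarrow> real"
  where "zeta_fun \<alpha> z x y =
    (if x = y then 1 / x
     else z / (\<alpha> * (1 - \<alpha>))
       * ((x powr ((1 - \<alpha>) / z) - y powr ((1 - \<alpha>) / z)) / (x - y))
       * ((x powr (\<alpha> / z) - y powr (\<alpha> / z)) / (x powr (1 / z) - y powr (1 / z))))"

end

theory Submission
  imports Defs
begin

text \<open>For Hermitian \<open>A = \<Sum>c P\<^sub>c\<close> and \<open>B = \<Sum>d Q\<^sub>d\<close> put
  \<open>T \<phi> A B X = \<Sum>\<phi> (c, d) P\<^sub>c X Q\<^sub>d\<close>. If \<open>\<phi>\<close> is the divided difference of \<open>f\<close>, then
  \<open>f A - f B = T \<phi> A B (A - B)\<close> exactly, so the functional calculus is differentiable with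
  derivative \<open>T \<phi> A A\<close> once \<open>T\<close> is jointly continuous. The latter is clear for polynomial \<open>\<phi>\<close> and
  follows in general by Stone-Weierstrass, because \<open>T \<phi> A B\<close> has norm at most \<open>sup \<bar>\<phi>\<bar>\<close> for the
  Frobenius norm.

  The first derivatives of the divergence are traces of a weight times the derivative of
  \<open>\<sigma> powr p\<close>. As \<open>trace \<sigma> = 1\<close>, the weight may be shifted by a multiple of \<open>\<sigma> powr (1 - p)\<close>, which
  makes it vanish at \<open>\<sigma> = \<rho>\<close>. Hence the second derivative at \<open>\<rho>\<close> only involves the first derivative of
  the weight, and comparing coefficients leaves a rational identity for \<open>\<zeta>\<close>.\<close>

section \<open>Complex matrices\<close>

text \<open>Componentwise bilinearity over the reals suffices, since bilinear maps in finite
  dimension are bounded. The interpretations \<open>mm\<close> and \<open>mv\<close> then provide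
  the limit and derivative rules for products.\<close>

lemma bounded_bilinear_matrix_mult:
  "bounded_bilinear ((**) :: complex^'n^'n \<Rightarrow> complex^'n^'n \<Rightarrow> complex^'n^'n)"
proof -
  have "bilinear ((**) :: complex^'n^'n \<Rightarrow> complex^'n^'n \<Rightarrow> complex^'n^'n)"
    unfolding bilinear_def linear_iff
    by (auto simp: matrix_matrix_mult_def vec_eq_iff sum.distrib algebra_simps
        scaleR_sum_right)
  then show ?thesis
    by (simp add: bilinear_conv_bounded_bilinear)
qed

lemma bounded_bilinear_matrix_vector_mult:
  "bounded_bilinear ((*v) :: complex^'n^'n \<Rightarrow> complex^'n \<Rightarrow> complex^'n)"
proof -
  have "bilinear ((*v) :: complex^'n^'n \<Rightarrow> complex^'n \<Rightarrow> complex^'n)"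
    unfolding bilinear_def linear_iff
    by (auto simp: matrix_vector_mult_def vec_eq_iff sum.distrib algebra_simps
        scaleR_sum_right)
  then show ?thesis
    by (simp add: bilinear_conv_bounded_bilinear)
qed

lemma bounded_linear_trace: "bounded_linear (trace :: complex^'n^'n \<Rightarrow> complex)"
  unfolding linear_conv_bounded_linear [symmetric] linear_iff
  by (auto simp: trace_def sum.distrib scaleR_sum_right)

interpretation mm: bounded_bilinear "(**) :: complex^'n^'n \<Rightarrow> complex^'n^'n \<Rightarrow> complex^'n^'n"
  by (rule bounded_bilinear_matrix_mult)

interpretation mv: bounded_bilinear "(*v) :: complex^'n^'n \<Rightarrow> complex^'n \<Rightarrow> complex^'n"
  by (rule bounded_bilinear_matrix_vector_mult)

lemma trace_sum: "trace (\<Sum>x\<in>X. f x) = (\<Sum>x\<in>X. trace (f x :: complex^'n^'n))"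
  by (rule linear_sum) (simp add: bounded_linear_trace bounded_linear.linear)

lemma trace_scaleR: "trace (c *\<^sub>R A) = c *\<^sub>R trace (A :: complex^'n^'n)"
  by (rule linear_scale) (simp add: bounded_linear_trace bounded_linear.linear)

section \<open>Adjoints and the real inner product\<close>

text \<open>As an operation, the adjoint turns the entrywise predicate \<open>hermitian\<close> into
  an equation that rewrites through sums and products.\<close>

definition ctranspose :: "complex^'n^'m \<Rightarrow> complex^'m^'n"
  where "ctranspose A = (\<chi> i j. cnj (A $ j $ i))"

lemma hermitian_iff_ctranspose: "hermitian A \<longleftrightarrow> ctranspose A = A"
  unfolding hermitian_def ctranspose_def vec_eq_iff vec_lambda_beta by (blast intro: sym)

lemma ctranspose_mult: "ctranspose (A ** B) = ctranspose B ** ctranspose A"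
  by (simp add: ctranspose_def matrix_matrix_mult_def vec_eq_iff mult.commute)

lemma ctranspose_add: "ctranspose (A + B) = ctranspose A + ctranspose B"
  by (simp add: ctranspose_def vec_eq_iff)

lemma ctranspose_scaleR: "ctranspose (c *\<^sub>R A) = c *\<^sub>R ctranspose A"
  by (simp add: ctranspose_def vec_eq_iff)

lemma ctranspose_sum: "ctranspose (\<Sum>x\<in>X. f x) = (\<Sum>x\<in>X. ctranspose (f x))"
  by (simp add: ctranspose_def vec_eq_iff sum_component)

lemma trace_ctranspose: "trace (ctranspose A) = cnj (trace A)"
  by (simp add: trace_def ctranspose_def)

lemma ctranspose_hermitian: "hermitian A \<Longrightarrow> ctranspose A = A"
  by (simp add: hermitian_iff_ctranspose)

lemma hermitian_scaleR: "hermitian A \<Longrightarrow> hermitian (c *\<^sub>R A)"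
  by (simp add: hermitian_iff_ctranspose ctranspose_scaleR)

lemma hermitian_sum: "(\<And>x. x \<in> X \<Longrightarrow> hermitian (f x)) \<Longrightarrow> hermitian (\<Sum>x\<in>X. f x)"
  by (simp add: hermitian_iff_ctranspose ctranspose_sum)

lemma inner_complex_eq_Re: "(a::complex) \<bullet> b = Re (cnj a * b)"
  by (simp add: inner_complex_def)

text \<open>The real inner product is the real part of the Hermitian one, so the real adjoint of a
  complex-linear map is still its conjugate transpose.\<close>

lemma inner_matrix_vector_mult:
  fixes A :: "complex^'n^'n"
  shows "x \<bullet> (A *v y) = (ctranspose A *v x) \<bullet> y"
proof -
  have "x \<bullet> (A *v y) = (\<Sum>i\<in>UNIV. \<Sum>j\<in>UNIV. Re (cnj (x$i) * (A$i$j * y$j)))"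
    by (simp add: inner_vec_def matrix_vector_mult_def inner_complex_eq_Re sum_distrib_left del: times_complex.simps)
  also have "\<dots> = (\<Sum>j\<in>UNIV. \<Sum>i\<in>UNIV. Re (cnj (x$i) * (A$i$j * y$j)))"
    by (rule sum.swap)
  also have "\<dots> = (ctranspose A *v x) \<bullet> y"
    unfolding inner_vec_def matrix_vector_mult_def ctranspose_def
    by (simp add: inner_complex_eq_Re sum_distrib_left sum_distrib_right  mult_ac del: times_complex.simps)
  finally show ?thesis .
qed

lemma inner_hermitian:
  fixes A :: "complex^'n^'n"
  shows "hermitian A \<Longrightarrow> x \<bullet> (A *v y) = (A *v x) \<bullet> y"
  by (simp add: inner_matrix_vector_mult hermitian_iff_ctranspose)

text \<open>Symmetry for the real inner product is enough: the real adjoint is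
  \<open>ctranspose A\<close>, and testing against all \<open>y\<close> identifies it with
  \<open>A\<close>.\<close>

lemma hermitianI:
  fixes A :: "complex^'n^'n"
  assumes "\<And>x y. x \<bullet> (A *v y) = (A *v x) \<bullet> y"
  shows "hermitian A"
proof -
  have "ctranspose A *v x = A *v x" for x
  proof -
    have "(ctranspose A *v x - A *v x) \<bullet> y = 0" for y
      using assms[of x y] by (simp add: inner_matrix_vector_mult inner_diff_left)
    then show ?thesis
      by (metis inner_eq_zero_iff right_minus_eq)
  qed
  then show ?thesis
    by (simp add: hermitian_iff_ctranspose matrix_eq)
qed

text \<open>The inner product of matrices is the real part of
  \<open>trace (ctranspose X ** Y)\<close>. The adjoints of left and right multiplication serve to
  show that different spectral blocks of a matrix are orthogonal.\<close>

lemma inner_matrix_mult_left: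
  fixes A X Y :: "complex^'n^'n"
  shows "(A ** X) \<bullet> Y = X \<bullet> (ctranspose A ** Y)"
proof -
  have "(A ** X) \<bullet> Y = (\<Sum>i\<in>UNIV. \<Sum>j\<in>UNIV. \<Sum>k\<in>UNIV. Re (cnj (A$i$k * X$k$j) * Y$i$j))"
    by (simp add: inner_vec_def matrix_matrix_mult_def inner_complex_eq_Re sum_distrib_left sum_distrib_right del: times_complex.simps)
  also have "\<dots> = (\<Sum>i\<in>UNIV. \<Sum>k\<in>UNIV. \<Sum>j\<in>UNIV. Re (cnj (A$i$k * X$k$j) * Y$i$j))"
    by (rule sum.cong[OF refl], rule sum.swap)
  also have "\<dots> = (\<Sum>k\<in>UNIV. \<Sum>i\<in>UNIV. \<Sum>j\<in>UNIV. Re (cnj (A$i$k * X$k$j) * Y$i$j))"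
    by (rule sum.swap)
  also have "\<dots> = (\<Sum>k\<in>UNIV. \<Sum>j\<in>UNIV. \<Sum>i\<in>UNIV. Re (cnj (A$i$k * X$k$j) * Y$i$j))"
    by (rule sum.cong[OF refl], rule sum.swap)
  also have "\<dots> = X \<bullet> (ctranspose A ** Y)"
    unfolding inner_vec_def matrix_matrix_mult_def ctranspose_def
    by (simp add: inner_complex_eq_Re sum_distrib_left sum_distrib_right  mult_ac del: times_complex.simps)
  finally show ?thesis .
qed

lemma inner_matrix_mult_right:
  fixes A X Y :: "complex^'n^'n"
  shows "(X ** A) \<bullet> Y = X \<bullet> (Y ** ctranspose A)"
proof -
  have "(X ** A) \<bullet> Y = (\<Sum>i\<in>UNIV. \<Sum>j\<in>UNIV. \<Sum>k\<in>UNIV. Re (cnj (X$i$k * A$k$j) * Y$i$j))"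
    by (simp add: inner_vec_def matrix_matrix_mult_def inner_complex_eq_Re sum_distrib_left sum_distrib_right del: times_complex.simps)
  also have "\<dots> = (\<Sum>i\<in>UNIV. \<Sum>k\<in>UNIV. \<Sum>j\<in>UNIV. Re (cnj (X$i$k * A$k$j) * Y$i$j))"
    by (rule sum.cong[OF refl], rule sum.swap)
  also have "\<dots> = X \<bullet> (Y ** ctranspose A)"
    unfolding inner_vec_def matrix_matrix_mult_def ctranspose_def
    by (simp add: inner_complex_eq_Re sum_distrib_left sum_distrib_right  mult_ac del: times_complex.simps)
  finally show ?thesis .
qed

section \<open>Orthogonal projections onto complex subspaces\<close>

text \<open>Each projection fixes the common range, so \<open>Q ** P = P\<close> and
  \<open>P ** Q = Q\<close>; the second product is the adjoint of the first.\<close>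

lemma eigenprojection_unique:
  fixes P Q :: "complex^'n^'n"
  assumes "hermitian P" "P ** P = P" "hermitian Q" "Q ** Q = Q"
    and "range ((*v) P) = range ((*v) Q)"
  shows "P = Q"
proof -
  have *: "Q ** P = P" if Q: "Q ** Q = Q" and r: "range ((*v) P) = range ((*v) Q)" for P Q :: "complex^'n^'n"
  proof -
    have "Q *v (P *v x) = P *v x" for x
    proof -
      obtain y where "P *v x = Q *v y" using r by blast
      then show ?thesis by (simp add: matrix_vector_mul_assoc Q)
    qed
    then show ?thesis by (simp add: matrix_eq matrix_vector_mul_assoc)
  qed
  have "P = ctranspose (Q ** P)"
    using * assms by (simp add: ctranspose_hermitian)
  also have "\<dots> = P ** Q"
    using assms by (simp add: ctranspose_mult ctranspose_hermitian)
  also have "\<dots> = Q" using * assms by simp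
  finally show ?thesis .
qed

text \<open>The decomposition is orthogonal for the real inner product; closure of \<open>V\<close>
  under complex scalars makes the projection complex linear and hence a matrix.\<close>

lemma orthogonal_projection_exists:
  fixes V :: "(complex^'n) set"
  assumes V: "subspace V" and Vs: "\<And>c x. x \<in> V \<Longrightarrow> c *s x \<in> V"
  obtains P :: "complex^'n^'n" where "hermitian P" "P ** P = P" "range ((*v) P) = V"
proof -
  have "\<exists>y. y \<in> V \<and> (\<forall>w\<in>V. (x - y) \<bullet> w = 0)" for x
  proof -
    obtain y z where "y \<in> span V" "\<And>w. w \<in> span V \<Longrightarrow> orthogonal z w" "x = y + z"
      using orthogonal_subspace_decomp_exists by blast
    then show ?thesis
      using V by (intro exI[of _ y]) (auto simp: orthogonal_def span_eq_iff[THEN iffD2])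
  qed
  then obtain p where p: "\<And>x. p x \<in> V" "\<And>x w. w \<in> V \<Longrightarrow> (x - p x) \<bullet> w = 0"
    by metis
  have uniq: "p x = y" if "y \<in> V" "\<And>w. w \<in> V \<Longrightarrow> (x - y) \<bullet> w = 0" for x y
  proof -
    have m: "p x - y \<in> V" using p that V by (simp add: subspace_diff)
    have "(p x - y) \<bullet> (p x - y) = (x - y) \<bullet> (p x - y) - (x - p x) \<bullet> (p x - y)"
      by (simp add: inner_diff_left)
    also have "\<dots> = 0" using p that m by simp
    finally show ?thesis by simp
  qed
  have cs: "(c *s x) \<bullet> w = x \<bullet> (cnj c *s w)" for c and x w :: "complex^'n"
    by (auto simp: inner_vec_def inner_complex_def algebra_simps intro!: sum.cong)
  have lin: "Vector_Spaces.linear (*s) (*s) p"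
  proof (unfold_locales)
    fix x y
    show "p (x + y) = p x + p y"
    proof (rule uniq)
      show "p x + p y \<in> V" using p V by (simp add: subspace_add)
      show "(x + y - (p x + p y)) \<bullet> w = 0" if "w \<in> V" for w
        using p(2)[OF that, of x] p(2)[OF that, of y]
        by (simp add: inner_diff_left inner_add_left)
    qed
  next
    fix c x
    \<comment> \<open>A scalar \<open>c\<close> moves to the other side of the inner product as
      \<open>cnj c\<close>, and \<open>cnj c *s w\<close> stays in \<open>V\<close>.\<close>
    show "p (c *s x) = c *s p x"
    proof (rule uniq)
      show "c *s p x \<in> V" using p Vs by simp
      show "(c *s x - c *s p x) \<bullet> w = 0" if "w \<in> V" for w
      proof -
        have "(c *s x - c *s p x) \<bullet> w = (x - p x) \<bullet> (cnj c *s w)"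
          by (simp add: cs inner_diff_left)
        then show ?thesis using p(2) Vs that by simp
      qed
    qed
  qed
  define P where "P = matrix p"
  have P: "P *v x = p x" for x unfolding P_def by (rule matrix_works[OF lin])
  have fixV: "p y = y" if "y \<in> V" for y by (rule uniq) (use that in auto)
  show ?thesis
  proof
    show "hermitian P"
    proof (rule hermitianI, unfold P)
      fix x y
      have "(x - p x) \<bullet> p y = 0" "(y - p y) \<bullet> p x = 0" using p by blast+
      then show "x \<bullet> p y = p x \<bullet> y"
        by (simp add: inner_diff_left inner_diff_right inner_commute)
    qed
    show "P ** P = P"
      by (simp add: matrix_eq flip: matrix_vector_mul_assoc) (simp add: P fixV p)
    show "range ((*v) P) = V"
      using P p fixV by (auto simp: image_iff) (metis)
  qed
qed

section \<open>Spectral theorem and double operator sums\<close>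

lemma matrix_vector_mult_sum: "(\<Sum>x\<in>X. f x) *v v = (\<Sum>x\<in>X. f x *v v)"
  for f :: "'a \<Rightarrow> complex^'n^'n"
  by (rule mv.sum_left)

section \<open>Eigenvectors and eigenprojections of Hermitian matrices\<close>

text \<open>A maximiser \<open>v\<close> of the Rayleigh quotient on the unit sphere of the
  invariant subspace is an eigenvector: perturbing it along a nonzero residual \<open>w\<close>
  would increase the quotient.\<close>

lemma hermitian_eigenvector_exists:
  fixes A :: "complex^'n^'n"
  assumes A: "hermitian A" and V: "subspace V" and inv: "\<And>x. x \<in> V \<Longrightarrow> A *v x \<in> V"
    and "x0 \<in> V" "x0 \<noteq> 0"
  obtains v c where "v \<in> V" "v \<noteq> 0" "A *v v = c *\<^sub>R v"
proof -
  define K where "K = V \<inter> sphere 0 1"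
  have "compact K"
    unfolding K_def by (intro closed_Int_compact closed_subspace V compact_sphere)
  moreover have "x0 /\<^sub>R norm x0 \<in> K"
    using assms by (auto simp: K_def subspace_scale)
  moreover have "continuous_on K (\<lambda>x. x \<bullet> (A *v x))"
    by (intro continuous_intros mv.continuous_on)
  ultimately obtain v where v: "v \<in> K" and max: "\<And>y. y \<in> K \<Longrightarrow> y \<bullet> (A *v y) \<le> v \<bullet> (A *v v)"
    using continuous_attains_sup[of K "\<lambda>x. x \<bullet> (A *v x)"] by blast
  define c where "c = v \<bullet> (A *v v)"
  have vV: "v \<in> V" and v1: "v \<bullet> v = 1"
    using v by (auto simp: K_def norm_eq_1)
  have le: "y \<bullet> (A *v y) \<le> c * (y \<bullet> y)" if "y \<in> V" for y
  proof (cases "y = 0")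
    case False
    have "y /\<^sub>R norm y \<in> K"
      using that False by (auto simp: K_def V subspace_scale)
    from max[OF this] have "(y \<bullet> (A *v y)) / (norm y)\<^sup>2 \<le> c"
      by (simp add: c_def mv.scaleR_right power2_eq_square field_simps)
    then show ?thesis
      using False by (simp add: field_simps power2_norm_eq_inner)
  qed simp
  define w where "w = A *v v - c *\<^sub>R v"
  have wV: "w \<in> V"
    using vV V inv by (auto simp: w_def subspace_diff subspace_scale)
  define q where "q = c * (w \<bullet> w) - w \<bullet> (A *v w)"
  \<comment> \<open>The terms with \<open>w \<bullet> v\<close> cancel; what is left compares a term
    linear in \<open>t\<close> with a quadratic one.\<close>
  have ineq: "2 * t * (w \<bullet> w) \<le> t\<^sup>2 * q" for t
  proof -
    have "(v + t *\<^sub>R w) \<bullet> (A *v (v + t *\<^sub>R w)) \<le> c * ((v + t *\<^sub>R w) \<bullet> (v + t *\<^sub>R w))"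
      by (intro le) (use vV wV V in \<open>auto simp: subspace_add subspace_scale\<close>)
    moreover have "v \<bullet> (A *v w) = w \<bullet> (A *v v)"
      using inner_hermitian[OF A] by (simp add: inner_commute)
    moreover have "w \<bullet> (A *v v) = w \<bullet> w + c * (w \<bullet> v)"
      by (simp add: w_def algebra_simps inner_diff_right)
    ultimately show ?thesis
      using v1 by (simp add: q_def mv.add_right mv.scaleR_right inner_add_left inner_add_right
          inner_commute[of v w] c_def[symmetric] power2_eq_square algebra_simps)
  qed
  have "w \<bullet> w = 0"
  proof (rule ccontr)
    assume "w \<bullet> w \<noteq> 0"
    then have pos: "0 < w \<bullet> w" by simp
    have "2 * (w \<bullet> w) \<le> t * q" if "t > 0" for t
      using ineq[of t] that by (simp add: power2_eq_square)
    \<comment> \<open>This \<open>t\<close> makes \<open>t * q\<close> at most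
      \<open>w \<bullet> w\<close>, half of what the inequality demands.\<close>
    from this[of "(w \<bullet> w) / (\<bar>q\<bar> + 1)"] pos
    have "2 * (w \<bullet> w) \<le> (w \<bullet> w) * (q / (\<bar>q\<bar> + 1))"
      by (simp add: field_simps)
    also have "\<dots> \<le> (w \<bullet> w) * 1"
      by (intro mult_left_mono) (auto simp: field_simps)
    finally show False using pos by simp
  qed
  then have "A *v v = c *\<^sub>R v" by (simp add: w_def)
  moreover have "v \<noteq> 0" using v1 by auto
  ultimately show ?thesis using vV that by blast
qed

text \<open>The eigenspace is closed under complex scalars, so exactly one orthogonal projection
  onto it exists and the definite description is justified. If \<open>c\<close> is no eigenvalue,
  this projection is zero.\<close>

lemma
  fixes A :: "complex^'n^'n"
  shows hermitian_eigenprojection: "hermitian (eigenprojection A c)"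
    and eigenprojection_idem: "eigenprojection A c ** eigenprojection A c = eigenprojection A c"
    and range_eigenprojection: "range ((*v) (eigenprojection A c)) = {x. A *v x = c *\<^sub>R x}"
proof -
  let ?Q = "\<lambda>P. hermitian P \<and> P ** P = P \<and> range ((*v) P) = {x. A *v x = c *\<^sub>R x}"
  have sub: "subspace {x. A *v x = c *\<^sub>R x}"
    by (auto simp: subspace_def mv.add_right mv.scaleR_right algebra_simps)
  have scale: "k *s x \<in> {x. A *v x = c *\<^sub>R x}" if "x \<in> {x. A *v x = c *\<^sub>R x}" for k x
  proof -
    have "A *v (k *s x) = k *s (A *v x)" by (rule vector_scalar_commute)
    also have "\<dots> = c *\<^sub>R (k *s x)" using that by (simp add: vec_eq_iff)
    finally show ?thesis by simp
  qed
  obtain P where P1: "hermitian P" "P ** P = P" "range ((*v) P) = {x. A *v x = c *\<^sub>R x}"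
    by (rule orthogonal_projection_exists[OF sub scale])
  then have P: "?Q P" by (intro conjI)
  have "?Q (eigenprojection A c)"
    unfolding eigenprojection_def
  proof (rule theI[of ?Q, OF P])
    fix P' assume P': "?Q P'"
    show "P' = P"
    proof (rule eigenprojection_unique)
      show "range ((*v) P') = range ((*v) P)"
        using P' P1(3) by (elim conjE) (rule trans, assumption, rule sym)
    qed (use P' P1(1,2) in blast)+
  qed
  then show "hermitian (eigenprojection A c)"
    "eigenprojection A c ** eigenprojection A c = eigenprojection A c"
    "range ((*v) (eigenprojection A c)) = {x. A *v x = c *\<^sub>R x}" by blast+
qed

lemma eigenprojection_eigenvector:
  fixes A :: "complex^'n^'n"
  assumes "A *v x = c *\<^sub>R x"
  shows "eigenprojection A c *v x = x"
proof -
  obtain y where "x = eigenprojection A c *v y"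
    using assms range_eigenprojection[of A c] by blast
  then show ?thesis
    by (simp add: matrix_vector_mul_assoc eigenprojection_idem)
qed

lemma eigenvector_eigenprojection:
  fixes A :: "complex^'n^'n"
  shows "A *v (eigenprojection A c *v x) = c *\<^sub>R (eigenprojection A c *v x)"
  using range_eigenprojection[of A c] by blast

lemma mult_eigenprojection:
  fixes A :: "complex^'n^'n"
  shows "A ** eigenprojection A c = c *\<^sub>R eigenprojection A c"
  by (simp add: matrix_eq eigenvector_eigenprojection mv.scaleR_left flip: matrix_vector_mul_assoc)

lemma eigenprojection_mult:
  fixes A :: "complex^'n^'n"
  assumes "hermitian A"
  shows "eigenprojection A c ** A = c *\<^sub>R eigenprojection A c"
  using arg_cong[OF mult_eigenprojection[of A c], of ctranspose] assms
  by (simp add: ctranspose_mult ctranspose_scaleR ctranspose_hermitian hermitian_eigenprojection)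

text \<open>Placing \<open>A\<close> between the two projections and absorbing it on either side
  gives the factor \<open>c\<close> or \<open>d\<close>.\<close>

lemma eigenprojection_orthogonal:
  fixes A :: "complex^'n^'n"
  assumes "hermitian A" "c \<noteq> d"
  shows "eigenprojection A c ** eigenprojection A d = 0"
proof -
  have "c *\<^sub>R (eigenprojection A c ** eigenprojection A d)
      = (eigenprojection A c ** A) ** eigenprojection A d"
    by (simp add: eigenprojection_mult assms mm.scaleR_left)
  also have "\<dots> = d *\<^sub>R (eigenprojection A c ** eigenprojection A d)"
    by (simp add: mult_eigenprojection mm.scaleR_right flip: matrix_mul_assoc)
  finally show ?thesis using assms by simp
qed

lemma eigenprojection_mult_if:
  fixes A :: "complex^'n^'n"
  assumes "hermitian A"
  shows "eigenprojection A c ** eigenprojection A d = (if c = d then eigenprojection A c else 0)"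
  using assms by (simp add: eigenprojection_idem eigenprojection_orthogonal)

text \<open>Expresses the spectrum through projections, the form in which it is carried over to
  powers of a matrix.\<close>

lemma eigenvalues_iff:
  fixes A :: "complex^'n^'n"
  shows "c \<in> eigenvalues A \<longleftrightarrow> eigenprojection A c \<noteq> 0"
proof
  assume "c \<in> eigenvalues A"
  then obtain x where "x \<noteq> 0" "A *v x = c *\<^sub>R x" by (auto simp: eigenvalues_def)
  then show "eigenprojection A c \<noteq> 0"
    using eigenprojection_eigenvector[of A x c] by auto
next
  assume "eigenprojection A c \<noteq> 0"
  then obtain x where "eigenprojection A c *v x \<noteq> 0"
    by (auto simp: matrix_eq)
  then show "c \<in> eigenvalues A"
    using eigenvector_eigenprojection[of A c x] by (auto simp: eigenvalues_def)
qed

text \<open>Eigenvectors for distinct eigenvalues are orthogonal, hence independent, and the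
  dimension is finite.\<close>

lemma finite_eigenvalues:
  fixes A :: "complex^'n^'n"
  assumes A: "hermitian A"
  shows "finite (eigenvalues A)"
proof -
  have "\<forall>c\<in>eigenvalues A. \<exists>x. x \<noteq> 0 \<and> A *v x = c *\<^sub>R x"
    by (simp add: eigenvalues_def)
  from bchoice[OF this] obtain v
    where v: "\<And>c. c \<in> eigenvalues A \<Longrightarrow> v c \<noteq> 0 \<and> A *v v c = c *\<^sub>R v c" by blast
  have orth: "v c \<bullet> v d = 0" if "c \<in> eigenvalues A" "d \<in> eigenvalues A" "c \<noteq> d" for c d
    using inner_hermitian[OF A, of "v c" "v d"] v[of c] v[of d] that by simp
  have "independent (v ` eigenvalues A)"
    using orth v
    by (intro pairwise_orthogonal_independent) (auto simp: pairwise_def orthogonal_def)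
  then have "finite (v ` eigenvalues A)" by (rule independent_imp_finite)
  moreover have "inj_on v (eigenvalues A)"
    using orth v by (intro inj_onI) (metis inner_eq_zero_iff)
  ultimately show ?thesis by (rule finite_imageD)
qed

text \<open>The orthogonal complement \<open>V\<close> of all eigenvectors is invariant; if nonzero,
  it would contain an eigenvector, which would be orthogonal to itself. So \<open>V\<close> is zero,
  and every \<open>y - E *v y\<close> lies in \<open>V\<close> because \<open>E\<close> is Hermitian
  and fixes eigenvectors.\<close>

lemma sum_eigenprojection:
  fixes A :: "complex^'n^'n"
  assumes A: "hermitian A"
  shows "(\<Sum>c\<in>eigenvalues A. eigenprojection A c) = mat 1"
proof -
  define E where "E = (\<Sum>c\<in>eigenvalues A. eigenprojection A c)"
  define W where "W = {x. \<exists>c. A *v x = c *\<^sub>R x}"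
  define V where "V = {y. \<forall>x\<in>W. x \<bullet> y = 0}"
  have subV: "subspace V"
    by (auto simp: subspace_def V_def inner_add_right)
  have inv: "A *v y \<in> V" if y: "y \<in> V" for y
    unfolding V_def
  proof (intro CollectI ballI)
    fix x assume x: "x \<in> W"
    then obtain c where "A *v x = c *\<^sub>R x" by (auto simp: W_def)
    then show "x \<bullet> (A *v y) = 0"
      using x y by (simp add: inner_hermitian[OF A] V_def)
  qed
  have V0: "y = 0" if "y \<in> V" for y
  proof (rule ccontr)
    assume "y \<noteq> 0"
    obtain v c where "v \<in> V" "v \<noteq> 0" "A *v v = c *\<^sub>R v"
      by (rule hermitian_eigenvector_exists[OF A subV inv \<open>y \<in> V\<close> \<open>y \<noteq> 0\<close>])
    then have "v \<in> W" by (auto simp: W_def)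
    with \<open>v \<in> V\<close> \<open>v \<noteq> 0\<close> show False by (auto simp: V_def)
  qed
  have "E *v y = y" for y
  proof -
    have "y - E *v y \<in> V"
      unfolding V_def
    proof (intro CollectI ballI)
      fix x assume "x \<in> W"
      then obtain c where x: "A *v x = c *\<^sub>R x" by (auto simp: W_def)
      show "x \<bullet> (y - E *v y) = 0"
      proof (cases "x = 0")
        case False
        then have c: "c \<in> eigenvalues A" using x by (auto simp: eigenvalues_def)
        have "E *v x = (\<Sum>d\<in>eigenvalues A. eigenprojection A d *v (eigenprojection A c *v x))"
          by (simp add: E_def matrix_vector_mult_sum eigenprojection_eigenvector[OF x])
        also have "\<dots> = (\<Sum>d\<in>eigenvalues A. if d = c then x else 0)"
          unfolding matrix_vector_mul_assoc eigenprojection_mult_if[OF A]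
          by (intro sum.cong) (auto simp: eigenprojection_eigenvector[OF x])
        also have "\<dots> = x" using c finite_eigenvalues[OF A] by simp
        finally have "E *v x = x" .
        moreover have "hermitian E"
          unfolding E_def by (intro hermitian_sum hermitian_eigenprojection)
        ultimately show ?thesis
          using inner_hermitian[of E x y] by (simp add: inner_diff_right)
      qed simp
    qed
    from V0[OF this] show ?thesis by simp
  qed
  then show ?thesis by (simp add: matrix_eq E_def)
qed

text \<open>The double operator sum is the Schur multiplier with symbol \<open>\<phi>\<close> in the eigenbases of
  \<open>A\<close> and \<open>B\<close>.\<close>

definition double_op_sum ::
    "(real \<times> real \<Rightarrow> real) \<Rightarrow> complex^'n^'n \<Rightarrow> complex^'n^'n \<Rightarrow> complex^'n^'n \<Rightarrow> complex^'n^'n"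
  where "double_op_sum \<phi> A B X =
    (\<Sum>c\<in>eigenvalues A. \<Sum>d\<in>eigenvalues B.
      \<phi> (c, d) *\<^sub>R (eigenprojection A c ** X ** eigenprojection B d))"

section \<open>Algebra of double operator sums\<close>

lemma double_op_sum_cong:
  assumes "\<And>c d. c \<in> eigenvalues A \<Longrightarrow> d \<in> eigenvalues B \<Longrightarrow> \<phi> (c, d) = \<psi> (c, d)"
  shows "double_op_sum \<phi> A B X = double_op_sum \<psi> A B X"
  using assms by (simp add: double_op_sum_def)

lemma double_op_sum_add:
  "double_op_sum (\<lambda>x. \<phi> x + \<psi> x) A B X = double_op_sum \<phi> A B X + double_op_sum \<psi> A B X"
  by (simp add: double_op_sum_def sum.distrib scaleR_left_distrib)

lemma double_op_sum_diff:
  "double_op_sum (\<lambda>x. \<phi> x - \<psi> x) A B X = double_op_sum \<phi> A B X - double_op_sum \<psi> A B X"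
  by (simp add: double_op_sum_def sum_subtractf scaleR_left_diff_distrib)

lemma double_op_sum_scale:
  "double_op_sum (\<lambda>x. k * \<phi> x) A B X = k *\<^sub>R double_op_sum \<phi> A B X"
  by (simp add: double_op_sum_def scaleR_sum_right)

lemma double_op_sum_scaleR_arg:
  "double_op_sum \<phi> A B (k *\<^sub>R X) = k *\<^sub>R double_op_sum \<phi> A B X"
  by (simp add: double_op_sum_def scaleR_sum_right mm.scaleR_left mm.scaleR_right mult.commute)

text \<open>Orthogonality of the projections leaves one summand: the block of \<open>X\<close> at
  \<open>(c, d)\<close> is merely rescaled.\<close>

lemma eigenprojection_double_op_sum:
  assumes "hermitian A" "hermitian B" "c \<in> eigenvalues A" "d \<in> eigenvalues B"
  shows "eigenprojection A c ** double_op_sum \<phi> A B X ** eigenprojection B d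
    = \<phi> (c, d) *\<^sub>R (eigenprojection A c ** X ** eigenprojection B d)"
proof -
  have "eigenprojection A c ** double_op_sum \<phi> A B X ** eigenprojection B d
    = (\<Sum>c'\<in>eigenvalues A. \<Sum>d'\<in>eigenvalues B. \<phi> (c', d') *\<^sub>R
       ((eigenprojection A c ** eigenprojection A c') ** X **
        (eigenprojection B d' ** eigenprojection B d)))"
    by (simp add: double_op_sum_def mm.sum_left mm.sum_right mm.scaleR_left mm.scaleR_right
        matrix_mul_assoc)
  also have "\<dots> = (\<Sum>c'\<in>eigenvalues A. \<Sum>d'\<in>eigenvalues B. if d = d' then if c = c' then
       \<phi> (c, d) *\<^sub>R (eigenprojection A c ** X ** eigenprojection B d) else 0 else 0)"
    by (intro sum.cong refl) (auto simp: eigenprojection_mult_if assms mm.zero_left mm.zero_right)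
  also have "\<dots> = \<phi> (c, d) *\<^sub>R (eigenprojection A c ** X ** eigenprojection B d)"
    using assms by (simp add: finite_eigenvalues)
  finally show ?thesis .
qed

text \<open>Blocks are rescaled one after the other, so composition multiplies symbols. This turns
  identities between symbols into identities between matrices.\<close>

lemma double_op_sum_mult:
  assumes "hermitian A" "hermitian B"
  shows "double_op_sum (\<lambda>x. \<phi> x * \<psi> x) A B X = double_op_sum \<phi> A B (double_op_sum \<psi> A B X)"
  unfolding double_op_sum_def[of "\<lambda>x. \<phi> x * \<psi> x"] double_op_sum_def[of \<phi>]
  by (intro sum.cong refl) (simp add: eigenprojection_double_op_sum assms)

lemma double_op_sum_one:
  assumes "hermitian A" "hermitian B"
  shows "double_op_sum (\<lambda>x. 1) A B X = X"
proof -
  have "double_op_sum (\<lambda>x. 1) A B X = (\<Sum>c\<in>eigenvalues A. eigenprojection A c) ** X **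
     (\<Sum>d\<in>eigenvalues B. eigenprojection B d)"
    by (simp add: double_op_sum_def mm.sum_left mm.sum_right) (rule sum.swap)
  then show ?thesis by (simp add: sum_eigenprojection assms)
qed

text \<open>For a symbol in the first variable alone, the projections of \<open>B\<close> sum to the
  identity and a left multiplication remains.\<close>

lemma double_op_sum_left:
  assumes "hermitian A" "hermitian B"
  shows "double_op_sum (\<lambda>x. f (fst x)) A B X = (\<Sum>c\<in>eigenvalues A. f c *\<^sub>R eigenprojection A c) ** X"
proof -
  have "double_op_sum (\<lambda>x. f (fst x)) A B X =
     (\<Sum>c\<in>eigenvalues A. f c *\<^sub>R eigenprojection A c) ** X **
     (\<Sum>d\<in>eigenvalues B. eigenprojection B d)"
    by (simp add: double_op_sum_def mm.sum_left mm.sum_right mm.scaleR_left) (rule sum.swap)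
  then show ?thesis by (simp add: sum_eigenprojection assms)
qed

lemma double_op_sum_right:
  assumes "hermitian A" "hermitian B"
  shows "double_op_sum (\<lambda>x. f (snd x)) A B X = X ** (\<Sum>d\<in>eigenvalues B. f d *\<^sub>R eigenprojection B d)"
proof -
  have "double_op_sum (\<lambda>x. f (snd x)) A B X =
     (\<Sum>c\<in>eigenvalues A. eigenprojection A c) ** X **
     (\<Sum>d\<in>eigenvalues B. f d *\<^sub>R eigenprojection B d)"
    by (simp add: double_op_sum_def mm.sum_left mm.sum_right mm.scaleR_right scaleR_sum_right) (rule sum.swap)
  then show ?thesis by (simp add: sum_eigenprojection assms)
qed

lemma spectral_decomposition:
  assumes "hermitian (A :: complex^'n^'n)"
  shows "(\<Sum>c\<in>eigenvalues A. c *\<^sub>R eigenprojection A c) = A"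
proof -
  have "A = A ** (\<Sum>c\<in>eigenvalues A. eigenprojection A c)"
    by (simp add: sum_eigenprojection assms)
  then show ?thesis by (simp add: mm.sum_right mult_eigenprojection)
qed

lemma double_op_sum_fst:
  assumes "hermitian A" "hermitian B"
  shows "double_op_sum fst A B X = A ** X"
  using double_op_sum_left[OF assms, of "\<lambda>x. x"] by (simp add: spectral_decomposition assms)

lemma double_op_sum_snd:
  assumes "hermitian A" "hermitian B"
  shows "double_op_sum snd A B X = X ** B"
  using double_op_sum_right[OF assms, of "\<lambda>x. x"] by (simp add: spectral_decomposition assms)

section \<open>Norms, adjoints and traces of double operator sums\<close>

text \<open>The blocks are pairwise orthogonal for the Frobenius inner product, so Pythagoras
  applies.\<close>

lemma norm_double_op_sum_sq:
  assumes A: "hermitian A" and B: "hermitian B"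
  shows "(norm (double_op_sum \<phi> A B X))\<^sup>2 = (\<Sum>(c, d)\<in>eigenvalues A \<times> eigenvalues B.
      (\<phi> (c, d))\<^sup>2 * (norm (eigenprojection A c ** X ** eigenprojection B d))\<^sup>2)"
proof -
  let ?f = "\<lambda>(c, d). \<phi> (c, d) *\<^sub>R (eigenprojection A c ** X ** eigenprojection B d)"
  have orth: "(eigenprojection A c ** X ** eigenprojection B d) \<bullet>
      (eigenprojection A c' ** X ** eigenprojection B d') = 0" if "c \<noteq> c' \<or> d \<noteq> d'" for c c' d d'
  proof -
    have "(eigenprojection A c ** X ** eigenprojection B d) \<bullet>
      (eigenprojection A c' ** X ** eigenprojection B d') =
      X \<bullet> ((eigenprojection A c ** eigenprojection A c') ** X **
        (eigenprojection B d' ** eigenprojection B d))"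
      unfolding inner_matrix_mult_right[of "eigenprojection A c ** X"]
      unfolding inner_matrix_mult_left
      by (simp add: matrix_mul_assoc ctranspose_hermitian hermitian_eigenprojection)
    then show ?thesis
      using that by (auto simp: eigenprojection_mult_if A B mm.zero_left mm.zero_right)
  qed
  have "(norm (sum ?f (eigenvalues A \<times> eigenvalues B)))\<^sup>2
      = (\<Sum>x\<in>eigenvalues A \<times> eigenvalues B. (norm (?f x))\<^sup>2)"
    by (intro norm_sum_Pythagorean)
      (auto simp: finite_eigenvalues A B pairwise_def orthogonal_def orth)
  moreover have "double_op_sum \<phi> A B X = sum ?f (eigenvalues A \<times> eigenvalues B)"
    by (simp add: double_op_sum_def sum.cartesian_product)
  ultimately show ?thesis
    by (simp add: case_prod_unfold power_mult_distrib)
qed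

text \<open>The blocks are compared with those for the constant symbol, whose double operator sum is
  \<open>X\<close>. The bound sees the symbol only through its size on the spectra, which makes
  approximation of symbols uniform in the matrices.\<close>

lemma norm_double_op_sum_le:
  assumes A: "hermitian A" and B: "hermitian B" and "0 \<le> e"
    and le: "\<And>c d. c \<in> eigenvalues A \<Longrightarrow> d \<in> eigenvalues B \<Longrightarrow> \<bar>\<phi> (c, d)\<bar> \<le> e"
  shows "norm (double_op_sum \<phi> A B X) \<le> e * norm X"
proof -
  have "(norm (double_op_sum \<phi> A B X))\<^sup>2 \<le> (\<Sum>(c, d)\<in>eigenvalues A \<times> eigenvalues B.
      e\<^sup>2 * (norm (eigenprojection A c ** X ** eigenprojection B d))\<^sup>2)"
    unfolding norm_double_op_sum_sq[OF A B]
    by (intro sum_mono) (auto intro!: mult_right_mono simp: abs_le_square_iff[symmetric] le assms(3))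
  also have "\<dots> = e\<^sup>2 * (norm (double_op_sum (\<lambda>x. 1) A B X))\<^sup>2"
    unfolding norm_double_op_sum_sq[OF A B]
    by (simp add: sum_distrib_left case_prod_unfold)
  also have "\<dots> = (e * norm X)\<^sup>2"
    by (simp add: double_op_sum_one A B power_mult_distrib)
  finally show ?thesis
    by (rule power2_le_imp_le) (simp add: assms)
qed

text \<open>The adjoint exchanges the two spectral indices, and symmetry of the symbol undoes
  this.\<close>

lemma hermitian_double_op_sum:
  assumes "hermitian A" "hermitian X" "\<And>c d. \<phi> (d, c) = \<phi> (c, d)"
  shows "hermitian (double_op_sum \<phi> A A X)"
proof -
  have "ctranspose (double_op_sum \<phi> A A X) =
     (\<Sum>c\<in>eigenvalues A. \<Sum>d\<in>eigenvalues A.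
      \<phi> (d, c) *\<^sub>R (eigenprojection A d ** X ** eigenprojection A c))"
    unfolding double_op_sum_def using assms
    by (simp add: ctranspose_sum ctranspose_scaleR ctranspose_mult ctranspose_hermitian
        hermitian_eigenprojection matrix_mul_assoc)
  also have "\<dots> = double_op_sum \<phi> A A X"
    unfolding double_op_sum_def by (rule sum.swap)
  finally show ?thesis by (simp add: hermitian_iff_ctranspose)
qed

text \<open>By cyclicity the trace pairs the block \<open>(c, d)\<close> of one factor with the
  block \<open>(d, c)\<close> of the other.\<close>

lemma trace_double_op_sum_mult:
  fixes X Y :: "complex^'n^'n"
  assumes A: "hermitian A"
  shows "trace (double_op_sum \<phi> A A X ** double_op_sum \<psi> A A Y) =
    (\<Sum>c\<in>eigenvalues A. \<Sum>d\<in>eigenvalues A. complex_of_real (\<phi> (c, d) * \<psi> (d, c)) *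
      trace (eigenprojection A c ** X ** eigenprojection A d ** Y))"
proof -
  let ?E = "eigenprojection A"
  \<comment> \<open>Idempotence supplies second copies of both projections, and cyclicity moves one
    of them to the far end.\<close>
  have tr: "trace (?E c ** X ** ?E d ** Z) = trace (?E c ** X ** ?E d ** (?E d ** Z ** ?E c))" for c d Z
  proof -
    have "trace (?E c ** X ** ?E d ** (?E d ** Z ** ?E c))
       = trace ((?E c ** X ** (?E d ** ?E d) ** Z) ** ?E c)"
      by (simp add: matrix_mul_assoc)
    also have "\<dots> = trace (?E c ** (?E c ** X ** (?E d ** ?E d) ** Z))"
      by (rule trace_mul_sym)
    also have "\<dots> = trace ((?E c ** ?E c) ** X ** ?E d ** Z)"
      by (simp only: matrix_mul_assoc[symmetric] eigenprojection_idem) (simp add: matrix_mul_assoc eigenprojection_idem)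
    finally show ?thesis by (simp add: eigenprojection_idem)
  qed
  have "trace (double_op_sum \<phi> A A X ** double_op_sum \<psi> A A Y) =
    (\<Sum>c\<in>eigenvalues A. \<Sum>d\<in>eigenvalues A. \<phi> (c, d) *\<^sub>R
      trace (?E c ** X ** ?E d ** double_op_sum \<psi> A A Y))"
    by (simp add: double_op_sum_def[of \<phi>] mm.sum_left mm.scaleR_left trace_sum trace_scaleR)
  also have "\<dots> = (\<Sum>c\<in>eigenvalues A. \<Sum>d\<in>eigenvalues A. \<phi> (c, d) *\<^sub>R
      (\<psi> (d, c) *\<^sub>R trace (?E c ** X ** ?E d ** (?E d ** Y ** ?E c))))"
    by (intro sum.cong refl)
      (subst tr, simp add: eigenprojection_double_op_sum A mm.scaleR_right trace_scaleR)
  finally show ?thesis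
    by (simp add: tr[symmetric] scaleR_conv_of_real mult.assoc)
qed

section \<open>Continuity and differentiation of powers\<close>

lemma pos_def_hermitian: "pos_def A \<Longrightarrow> hermitian A"
  by (simp add: pos_def_def)

lemma pos_def_eigenvalue_pos:
  assumes "pos_def A" "c \<in> eigenvalues A"
  shows "0 < c"
proof -
  obtain x where x: "x \<noteq> 0" "A *v x = c *\<^sub>R x"
    using assms(2) by (auto simp: eigenvalues_def)
  then have "0 < x \<bullet> (c *\<^sub>R x)"
    using assms(1) unfolding pos_def_def x(2)[symmetric] by blast
  then have "0 < c * (x \<bullet> x)" by simp
  then show ?thesis using x(1) by (metis inner_gt_zero_iff zero_less_mult_pos2)
qed

text \<open>The quadratic form at \<open>x\<close> is the sum of \<open>f c\<close> times the
  squared norm of the projection of \<open>x\<close>, and these projections cannot all vanish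
  because they add up to \<open>x\<close>.\<close>

lemma pos_def_spectral_sum:
  fixes A :: "complex^'n^'n"
  assumes A: "hermitian A" and pos: "\<And>c. c \<in> eigenvalues A \<Longrightarrow> 0 < f c"
  shows "pos_def (\<Sum>c\<in>eigenvalues A. f c *\<^sub>R eigenprojection A c)"
  unfolding pos_def_def
proof (intro conjI allI impI)
  show "hermitian (\<Sum>c\<in>eigenvalues A. f c *\<^sub>R eigenprojection A c)"
    by (intro hermitian_sum hermitian_scaleR hermitian_eigenprojection)
  fix x :: "complex^'n" assume "x \<noteq> 0"
  have sq: "x \<bullet> (eigenprojection A c *v x)
      = (eigenprojection A c *v x) \<bullet> (eigenprojection A c *v x)" for c
    by (metis eigenprojection_idem hermitian_eigenprojection inner_hermitian matrix_vector_mul_assoc)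
  have "\<exists>c\<in>eigenvalues A. eigenprojection A c *v x \<noteq> 0"
  proof (rule ccontr)
    assume "\<not> ?thesis"
    then have "(\<Sum>c\<in>eigenvalues A. eigenprojection A c) *v x = 0"
      by (simp add: matrix_vector_mult_sum)
    then show False using \<open>x \<noteq> 0\<close> by (simp add: sum_eigenprojection A)
  qed
  then obtain c where c: "c \<in> eigenvalues A" "eigenprojection A c *v x \<noteq> 0" by blast
  have "0 < (\<Sum>c\<in>eigenvalues A. f c * ((eigenprojection A c *v x) \<bullet> (eigenprojection A c *v x)))"
    using c pos by (intro sum_pos2[OF finite_eigenvalues[OF A] c(1)]) (auto simp: less_imp_le)
  also have "\<dots> = x \<bullet> ((\<Sum>c\<in>eigenvalues A. f c *\<^sub>R eigenprojection A c) *v x)"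
    by (simp add: matrix_vector_mult_sum inner_sum_right mv.scaleR_left sq)
  finally show "0 < x \<bullet> ((\<Sum>c\<in>eigenvalues A. f c *\<^sub>R eigenprojection A c) *v x)" .
qed

lemma pos_def_op_powr: "pos_def A \<Longrightarrow> pos_def (op_powr A p)"
  unfolding op_powr_def
  by (rule pos_def_spectral_sum) (use pos_def_eigenvalue_pos in \<open>force simp: pos_def_hermitian\<close>)+

lemma pos_def_congruence:
  fixes A B :: "complex^'n^'n"
  assumes "pos_def A" "pos_def B"
  shows "pos_def (A ** B ** A)"
  unfolding pos_def_def
proof (intro conjI allI impI)
  have h: "hermitian A" "hermitian B" using assms by (simp_all add: pos_def_hermitian)
  show "hermitian (A ** B ** A)"
    using h by (simp add: hermitian_iff_ctranspose ctranspose_mult matrix_mul_assoc)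
  fix x :: "complex^'n" assume "x \<noteq> 0"
  then have "0 < x \<bullet> (A *v x)" using assms by (simp add: pos_def_def)
  then have "A *v x \<noteq> 0" by auto
  then have "0 < (A *v x) \<bullet> (B *v (A *v x))" using assms by (simp add: pos_def_def)
  then show "0 < x \<bullet> ((A ** B ** A) *v x)"
    by (simp add: inner_hermitian[OF h(1)] flip: matrix_vector_mul_assoc)
qed

lemma pos_def_trace_pos:
  fixes A :: "complex^'n^'n"
  assumes "pos_def A"
  shows "0 < Re (trace A)"
proof -
  have "0 < Re (A $ i $ i)" for i
  proof -
    have "0 < axis i 1 \<bullet> (A *v axis i 1)" using assms by (simp add: pos_def_def)
    moreover have "(A *v axis i 1) $ i = A $ i $ i"
      by (simp add: matrix_vector_mult_def axis_def if_distrib cong: if_cong)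
    ultimately show ?thesis by (simp add: inner_axis' inner_complex_def)
  qed
  then show ?thesis by (auto simp: trace_def intro!: sum_pos)
qed

lemma op_powr_one:
  assumes "pos_def A"
  shows "op_powr A 1 = A"
proof -
  have "op_powr A 1 = (\<Sum>c\<in>eigenvalues A. c *\<^sub>R eigenprojection A c)"
    unfolding op_powr_def
    by (intro sum.cong refl) (simp add: pos_def_eigenvalue_pos[OF assms] abs_of_pos)
  then show ?thesis by (simp add: spectral_decomposition pos_def_hermitian assms)
qed

lemma op_powr_mult_left:
  assumes "hermitian A" "hermitian B"
  shows "op_powr A p ** X = double_op_sum (\<lambda>x. fst x powr p) A B X"
  by (simp add: op_powr_def double_op_sum_left[OF assms, of "\<lambda>c. c powr p"])

lemma op_powr_mult_right:
  assumes "hermitian A" "hermitian B"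
  shows "X ** op_powr B p = double_op_sum (\<lambda>x. snd x powr p) A B X"
  by (simp add: op_powr_def double_op_sum_right[OF assms, of "\<lambda>c. c powr p"])

text \<open>Applied to the identity matrix, powers become double operator sums, and multiplying
  symbols adds the exponents.\<close>

lemma op_powr_add:
  fixes A :: "complex^'n^'n"
  assumes "hermitian A"
  shows "op_powr A p ** op_powr A q = op_powr A (p + q)"
proof -
  have "op_powr A p ** (op_powr A q ** mat 1) = op_powr A (p + q) ** mat 1"
    by (simp only: op_powr_mult_left[OF assms assms] powr_add
        double_op_sum_mult[OF assms assms, symmetric])
  then show ?thesis by simp
qed

lemma powr_base_inj:
  fixes x y p :: real
  assumes "0 < x" "0 < y" "p \<noteq> 0" "x powr p = y powr p"
  shows "x = y"
proof -
  have "(x powr p) powr (1 / p) = (y powr p) powr (1 / p)" using assms by simp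
  then show ?thesis using assms(1-3) by (simp add: powr_powr)
qed

text \<open>The map \<open>c powr p\<close> is injective on positive reals for nonzero
  \<open>p\<close>, so no two eigenspaces merge.\<close>

lemma op_powr_eigenspace:
  fixes A :: "complex^'n^'n"
  assumes A: "pos_def A" and c: "0 < c" and p: "p \<noteq> 0"
  shows "{x. op_powr A p *v x = (c powr p) *\<^sub>R x} = {x. A *v x = c *\<^sub>R x}"
proof (intro set_eqI iffI; unfold mem_Collect_eq)
  have h: "hermitian A" using A by (rule pos_def_hermitian)
  fix x
  have dec: "(\<Sum>d\<in>eigenvalues A. eigenprojection A d *v x) = x"
    using sum_eigenprojection[OF h] by (simp flip: matrix_vector_mult_sum)
  have pw: "op_powr A p *v x = (\<Sum>d\<in>eigenvalues A. (d powr p) *\<^sub>R (eigenprojection A d *v x))"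
    by (simp add: op_powr_def matrix_vector_mult_sum mv.scaleR_left)
  {
    assume x: "A *v x = c *\<^sub>R x"
    have z: "eigenprojection A d *v x = 0" if "d \<noteq> c" for d
    proof -
      have "eigenprojection A d *v x = eigenprojection A d *v (eigenprojection A c *v x)"
        by (simp only: eigenprojection_eigenvector[OF x])
      then show ?thesis
        using that by (simp add: matrix_vector_mul_assoc eigenprojection_orthogonal h)
    qed
    have "op_powr A p *v x = (\<Sum>d\<in>eigenvalues A. (c powr p) *\<^sub>R (eigenprojection A d *v x))"
      unfolding pw by (intro sum.cong refl) (metis z scaleR_zero_right)
    then show "op_powr A p *v x = (c powr p) *\<^sub>R x"
      by (simp add: dec flip: scaleR_sum_right)
  next
    assume x: "op_powr A p *v x = (c powr p) *\<^sub>R x"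
    have z: "eigenprojection A d *v x = 0" if d: "d \<in> eigenvalues A" and "d \<noteq> c" for d
    proof -
      \<comment> \<open>Projecting the eigenvector equation onto the eigenspace for \<open>d\<close>
        yields the factors \<open>d powr p\<close> and \<open>c powr p\<close> on the two
        sides.\<close>
      have "(\<Sum>e\<in>eigenvalues A. (e powr p) *\<^sub>R (eigenprojection A d *v (eigenprojection A e *v x)))
          = (\<Sum>e\<in>eigenvalues A. if d = e then (d powr p) *\<^sub>R (eigenprojection A d *v x) else 0)"
        by (intro sum.cong refl) (simp add: matrix_vector_mul_assoc eigenprojection_mult_if h)
      then have "eigenprojection A d *v (op_powr A p *v x) = (d powr p) *\<^sub>R (eigenprojection A d *v x)"
        by (simp add: pw mv.sum_right mv.scaleR_right d finite_eigenvalues h)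
      then have "(c powr p) *\<^sub>R (eigenprojection A d *v x) = (d powr p) *\<^sub>R (eigenprojection A d *v x)"
        by (simp only: x mv.scaleR_right)
      moreover have "d powr p \<noteq> c powr p"
        using that c p pos_def_eigenvalue_pos[OF A d] powr_base_inj by blast
      ultimately show ?thesis unfolding scaleR_cancel_right by auto
    qed
    have "A *v x = (\<Sum>d\<in>eigenvalues A. d *\<^sub>R (eigenprojection A d *v x))"
      by (subst (1) spectral_decomposition[OF h, symmetric])
        (simp add: matrix_vector_mult_sum mv.scaleR_left)
    also have "\<dots> = (\<Sum>d\<in>eigenvalues A. c *\<^sub>R (eigenprojection A d *v x))"
      by (intro sum.cong refl) (metis z scaleR_zero_right)
    finally show "A *v x = c *\<^sub>R x"
      by (simp add: dec flip: scaleR_sum_right)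
  }
qed

lemma eigenprojection_op_powr:
  assumes "pos_def A" "0 < c" "p \<noteq> 0"
  shows "eigenprojection (op_powr A p) (c powr p) = eigenprojection A c"
  unfolding eigenprojection_def op_powr_eigenspace[OF assms] ..

lemma eigenvalues_op_powr:
  assumes A: "pos_def A" and p: "p \<noteq> 0"
  shows "eigenvalues (op_powr A p) = (\<lambda>c. c powr p) ` eigenvalues A"
proof (intro set_eqI iffI)
  fix d assume d: "d \<in> eigenvalues (op_powr A p)"
  then have "0 < d" using pos_def_eigenvalue_pos pos_def_op_powr A by blast
  then have dd: "d = (d powr (1/p)) powr p" using p by (simp add: powr_powr)
  then have "eigenprojection A (d powr (1/p)) \<noteq> 0"
    using d eigenprojection_op_powr[OF A _ p, of "d powr (1/p)"] \<open>0 < d\<close> by (simp add: eigenvalues_iff)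
  then show "d \<in> (\<lambda>c. c powr p) ` eigenvalues A"
    using dd by (auto simp: eigenvalues_iff)
next
  fix d assume "d \<in> (\<lambda>c. c powr p) ` eigenvalues A"
  then obtain c where "c \<in> eigenvalues A" "d = c powr p" by blast
  then show "d \<in> eigenvalues (op_powr A p)"
    using eigenprojection_op_powr[OF A _ p, of c] pos_def_eigenvalue_pos[OF A] by (simp add: eigenvalues_iff)
qed

lemma inj_on_powr_eigenvalues:
  assumes A: "pos_def A" and p: "(p::real) \<noteq> 0"
  shows "inj_on (\<lambda>c. c powr p) (eigenvalues A)"
proof (rule inj_onI)
  fix x y assume "x \<in> eigenvalues A" "y \<in> eigenvalues A" "x powr p = y powr p"
  then show "x = y"
    using powr_base_inj[of x y p] pos_def_eigenvalue_pos[OF A] p by blast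
qed

lemma op_powr_op_powr:
  assumes A: "pos_def A" and p: "p \<noteq> 0"
  shows "op_powr (op_powr A p) q = op_powr A (p * q)"
  unfolding op_powr_def[of "op_powr A p"] op_powr_def[of A "p * q"] eigenvalues_op_powr[OF A p]
  using pos_def_eigenvalue_pos[OF A]
  by (simp add: sum.reindex inj_on_powr_eigenvalues A p eigenprojection_op_powr powr_powr)

text \<open>A matrix and its power share their eigenprojections, so only the arguments of the symbol
  change. With exponent \<open>1 / z\<close> this moves calculations from the core of the divergence
  back to the state.\<close>

lemma double_op_sum_op_powr:
  assumes A: "pos_def A" and p: "p \<noteq> 0"
  shows "double_op_sum \<phi> (op_powr A p) (op_powr A p) X
    = double_op_sum (\<lambda>x. \<phi> (fst x powr p, snd x powr p)) A A X"
  unfolding double_op_sum_def eigenvalues_op_powr[OF A p]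
  using pos_def_eigenvalue_pos[OF A]
  by (simp add: sum.reindex inj_on_powr_eigenvalues A p eigenprojection_op_powr)

section \<open>Joint continuity of double operator sums\<close>

text \<open>The coordinate symbols give the products with \<open>A\<close> and \<open>B\<close>,
  which are continuous. A product of symbols is a composition, so the induction has to keep the
  argument \<open>X\<close> arbitrary.\<close>

lemma tendsto_double_op_sum_polynomial:
  assumes "real_polynomial_function \<phi>"
    and A: "(A \<longlongrightarrow> A0) F" "\<And>t. hermitian (A t)" "hermitian A0"
    and B: "(B \<longlongrightarrow> B0) F" "\<And>t. hermitian (B t)" "hermitian B0"
    and X: "(X \<longlongrightarrow> X0) F"
  shows "((\<lambda>t. double_op_sum \<phi> (A t) (B t) (X t)) \<longlongrightarrow> double_op_sum \<phi> A0 B0 X0) F"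
  using assms(1) X
proof (induction arbitrary: X X0 rule: real_polynomial_function.induct)
  case (linear f)
  have f: "f = (\<lambda>x. f (1, 0) * fst x + f (0, 1) * snd x)"
  proof
    fix x :: "real \<times> real"
    have "f x = f (fst x *\<^sub>R (1, 0) + snd x *\<^sub>R (0, 1))" by simp
    also have "\<dots> = fst x *\<^sub>R f (1, 0) + snd x *\<^sub>R f (0, 1)"
      using linear(1) by (simp only: linear_simps)
    finally show "f x = f (1, 0) * fst x + f (0, 1) * snd x" by (simp add: mult.commute)
  qed
  have *: "double_op_sum f A B X = f (1, 0) *\<^sub>R (A ** X) + f (0, 1) *\<^sub>R (X ** B)"
    if "hermitian A" "hermitian B" for A B X
    by (subst f) (simp only: double_op_sum_add double_op_sum_scale double_op_sum_fst double_op_sum_snd that)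
  show ?case
    unfolding *[OF A(2) B(2)] *[OF A(3) B(3)]
    by (intro tendsto_intros mm.tendsto A B linear)
next
  case (const c)
  have *: "double_op_sum (\<lambda>x. c) A B X = c *\<^sub>R X" if "hermitian A" "hermitian B" for A B X
    using double_op_sum_scale[of c "\<lambda>x. 1" A B X] by (simp add: double_op_sum_one that)
  show ?case
    unfolding *[OF A(2) B(2)] *[OF A(3) B(3)] by (intro tendsto_intros const)
next
  case (add f g)
  then show ?case by (simp add: double_op_sum_add tendsto_add)
next
  case (mult f g)
  then show ?case by (simp add: double_op_sum_mult A B)
qed

text \<open>An eigenvalue is the quadratic form at a unit eigenvector. The form of \<open>A0\<close>
  is at least its minimum \<open>m\<close> on the sphere, and a small perturbation changes it by at
  most \<open>m / 2\<close>.\<close>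

lemma eigenvalues_locally_bounded:
  fixes A0 :: "complex^'n^'n"
  assumes "pos_def A0"
  obtains a b \<delta> where "0 < a" "0 < \<delta>" "\<And>A. dist A A0 < \<delta> \<Longrightarrow> eigenvalues A \<subseteq> {a..b}"
proof -
  from mv.pos_bounded obtain K where K: "0 < K"
    "\<And>(A :: complex^'n^'n) x. norm (A *v x) \<le> norm A * norm x * K" by blast
  have "compact (sphere (0::complex^'n) 1)" by (rule compact_sphere)
  moreover have "sphere (0::complex^'n) 1 \<noteq> {}" by simp
  moreover have "continuous_on (sphere 0 1) (\<lambda>x. x \<bullet> (A0 *v x))"
    by (intro continuous_intros mv.continuous_on)
  ultimately obtain v where v: "v \<in> sphere 0 1"
    and min: "\<And>y. y \<in> sphere 0 1 \<Longrightarrow> v \<bullet> (A0 *v v) \<le> y \<bullet> (A0 *v y)"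
    using continuous_attains_inf[of "sphere 0 1" "\<lambda>x. x \<bullet> (A0 *v x)"] by blast
  define m where "m = v \<bullet> (A0 *v v)"
  have "v \<noteq> 0" using v by auto
  then have m: "0 < m" using assms by (simp add: m_def pos_def_def)
  show ?thesis
  proof
    \<comment> \<open>The radius \<open>m / (2 * K)\<close> comes from the bound \<open>K\<close>
      for the matrix-vector product.\<close>
    show "0 < m / 2" "0 < m / (2 * K)" using m K by simp_all
    fix A assume A: "dist A A0 < m / (2 * K)"
    show "eigenvalues A \<subseteq> {m / 2..norm A0 * K + m / 2}"
    proof
      fix c assume "c \<in> eigenvalues A"
      then obtain x where x: "x \<noteq> 0" "A *v x = c *\<^sub>R x" by (auto simp: eigenvalues_def)
      define y where "y = x /\<^sub>R norm x"
      have y1: "norm y = 1" using x(1) by (simp add: y_def)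
      have "A *v y = c *\<^sub>R y" by (simp add: y_def mv.scaleR_right x)
      then have "y \<bullet> (A *v y) = c * (y \<bullet> y)" by (simp only: inner_scaleR_right)
      then have c: "c = y \<bullet> (A *v y)" using y1 by (simp add: norm_eq_1)
      also have "\<dots> = y \<bullet> (A0 *v y) + y \<bullet> ((A - A0) *v y)"
        by (simp add: mv.diff_left inner_diff_right)
      finally have c: "c = y \<bullet> (A0 *v y) + y \<bullet> ((A - A0) *v y)" .
      have "\<bar>y \<bullet> ((A - A0) *v y)\<bar> \<le> norm ((A - A0) *v y)"
        using Cauchy_Schwarz_ineq2[of y "(A - A0) *v y"] y1 by simp
      also have "\<dots> \<le> norm (A - A0) * K" using K(2)[of "A - A0" y] y1 by simp
      also have "\<dots> \<le> m / 2" using A K(1) by (simp add: dist_norm field_simps)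
      finally have 1: "\<bar>y \<bullet> ((A - A0) *v y)\<bar> \<le> m / 2" .
      have "\<bar>y \<bullet> (A0 *v y)\<bar> \<le> norm (A0 *v y)"
        using Cauchy_Schwarz_ineq2[of y "A0 *v y"] y1 by simp
      also have "\<dots> \<le> norm A0 * K" using K(2)[of A0 y] y1 by simp
      finally have 2: "\<bar>y \<bullet> (A0 *v y)\<bar> \<le> norm A0 * K" .
      have "m \<le> y \<bullet> (A0 *v y)" using min[of y] y1 by (simp add: m_def)
      then show "c \<in> {m / 2..norm A0 * K + m / 2}" using 1 2 c by auto
    qed
  qed
qed

text \<open>Near the limits all spectra lie in one compact rectangle inside the positive quadrant.
  There a polynomial approximates the symbol uniformly, and the norm bound transfers the error to
  the double operator sums.\<close>

lemma tendsto_double_op_sum: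
  fixes A B X :: "'b \<Rightarrow> complex^'n^'n"
  assumes \<phi>: "continuous_on ({0<..} \<times> {0<..}) \<phi>"
    and A: "(A \<longlongrightarrow> A0) F" "\<And>t. hermitian (A t)" "pos_def A0"
    and B: "(B \<longlongrightarrow> B0) F" "\<And>t. hermitian (B t)" "pos_def B0"
    and X: "(X \<longlongrightarrow> X0) F"
  shows "((\<lambda>t. double_op_sum \<phi> (A t) (B t) (X t)) \<longlongrightarrow> double_op_sum \<phi> A0 B0 X0) F"
proof (rule tendstoI)
  fix e :: real assume e: "0 < e"
  obtain a b \<delta> where a: "0 < a" "0 < \<delta>" "\<And>A. dist A A0 < \<delta> \<Longrightarrow> eigenvalues A \<subseteq> {a..b}"
    using eigenvalues_locally_bounded[OF A(3)] by metis
  obtain a' b' \<delta>' where a': "0 < a'" "0 < \<delta>'" "\<And>B. dist B B0 < \<delta>' \<Longrightarrow> eigenvalues B \<subseteq> {a'..b'}"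
    using eigenvalues_locally_bounded[OF B(3)] by metis
  \<comment> \<open>\<open>N\<close> eventually bounds the norm of \<open>X t\<close>, and
    \<open>\<eta>\<close> is chosen so that \<open>\<eta> * N = e / 4\<close>; three errors of size
    \<open>e / 4\<close> stay below \<open>e\<close>.\<close>
  define N where "N = norm X0 + 1"
  have N: "0 < N" by (simp add: N_def add_nonneg_pos)
  define \<eta> where "\<eta> = e / (4 * N)"
  have \<eta>: "0 < \<eta>" "\<eta> * N = e / 4" using e N by (simp_all add: \<eta>_def)
  have "compact ({a..b} \<times> {a'..b'})" by (intro compact_Times compact_Icc)
  moreover have "continuous_on ({a..b} \<times> {a'..b'}) \<phi>"
    by (rule continuous_on_subset[OF \<phi>]) (use a(1) a'(1) in auto)
  ultimately obtain g where g: "real_polynomial_function g"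
      "\<And>x. x \<in> {a..b} \<times> {a'..b'} \<Longrightarrow> \<bar>\<phi> x - g x\<bar> < \<eta>"
    using Stone_Weierstrass_real_polynomial_function \<eta>(1) by metis
  have approx: "dist (double_op_sum \<phi> A B X) (double_op_sum g A B X) \<le> e / 4"
    if "dist A A0 < \<delta>" "dist B B0 < \<delta>'" "norm X \<le> N" "hermitian A" "hermitian B" for A B X
  proof -
    have "dist (double_op_sum \<phi> A B X) (double_op_sum g A B X)
        = norm (double_op_sum (\<lambda>x. \<phi> x - g x) A B X)"
      by (simp add: dist_norm double_op_sum_diff)
    also have "\<dots> \<le> \<eta> * norm X"
    proof (rule norm_double_op_sum_le)
      fix c d assume "c \<in> eigenvalues A" "d \<in> eigenvalues B"
      then have "(c, d) \<in> {a..b} \<times> {a'..b'}" using a(3) a'(3) that by blast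
      then show "\<bar>\<phi> (c, d) - g (c, d)\<bar> \<le> \<eta>" using g(2) by fastforce
    qed (use that \<eta> in auto)
    also have "\<dots> \<le> \<eta> * N" using that \<eta> by simp
    finally show ?thesis using \<eta> by simp
  qed
  have "((\<lambda>t. double_op_sum g (A t) (B t) (X t)) \<longlongrightarrow> double_op_sum g A0 B0 X0) F"
    by (intro tendsto_double_op_sum_polynomial g A B X pos_def_hermitian)
  then have ev: "\<forall>\<^sub>F t in F. dist (double_op_sum g (A t) (B t) (X t)) (double_op_sum g A0 B0 X0) < e / 4"
    using e by (intro tendstoD) auto
  have at0: "dist (double_op_sum \<phi> A0 B0 X0) (double_op_sum g A0 B0 X0) \<le> e / 4"
    by (rule approx) (use a a' A B pos_def_hermitian in \<open>auto simp: N_def\<close>)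
  have "\<forall>\<^sub>F t in F. norm (X t) < N"
    using tendsto_norm[OF X] by (rule order_tendstoD) (simp add: N_def)
  then show "\<forall>\<^sub>F t in F. dist (double_op_sum \<phi> (A t) (B t) (X t)) (double_op_sum \<phi> A0 B0 X0) < e"
    using ev tendstoD[OF A(1) a(2)] tendstoD[OF B(1) a'(2)]
  proof eventually_elim
    case (elim t)
    have "dist (double_op_sum \<phi> (A t) (B t) (X t)) (double_op_sum g (A t) (B t) (X t)) \<le> e / 4"
      by (rule approx) (use elim A B in auto)
    with at0 elim(2) e show ?case
      using dist_triangle[of "double_op_sum \<phi> (A t) (B t) (X t)" "double_op_sum \<phi> A0 B0 X0"
            "double_op_sum g (A t) (B t) (X t)"]
        dist_triangle[of "double_op_sum g (A t) (B t) (X t)" "double_op_sum \<phi> A0 B0 X0"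
            "double_op_sum g A0 B0 X0"]
      by (simp add: dist_commute)
  qed
qed

section \<open>Divided differences of power functions\<close>

text \<open>The diagonal value is the derivative, which makes the function continuous there; the
  pair argument lets it serve as a symbol.\<close>

definition powr_divdiff :: "real \<Rightarrow> real \<times> real \<Rightarrow> real"
  where "powr_divdiff p x = (if fst x = snd x then p * fst x powr (p - 1)
     else (fst x powr p - snd x powr p) / (fst x - snd x))"

lemma powr_divdiff_commute: "powr_divdiff p (y, x) = powr_divdiff p (x, y)"
  by (simp add: powr_divdiff_def divide_simps) (simp add: algebra_simps)

text \<open>Brings both branches into one form, so that a diagonal point can be approached on and
  off the diagonal alike.\<close>

lemma powr_divdiff_mean_value:
  assumes "0 < x" "0 < y"
  shows "\<exists>\<xi>. min x y \<le> \<xi> \<and> \<xi> \<le> max x y \<and> powr_divdiff p (x, y) = p * \<xi> powr (p - 1)"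
proof -
  have *: "\<exists>\<xi>. min x y \<le> \<xi> \<and> \<xi> \<le> max x y \<and> powr_divdiff p (x, y) = p * \<xi> powr (p - 1)"
    if "0 < x" "x < y" for x y
  proof -
    have "\<exists>\<xi>. x < \<xi> \<and> \<xi> < y \<and> y powr p - x powr p = (y - x) * (p * \<xi> powr (p - 1))"
      using that by (intro MVT2) (auto intro!: derivative_eq_intros simp: powr_diff)
    then obtain \<xi> where "x < \<xi>" "\<xi> < y" "y powr p - x powr p = (y - x) * (p * \<xi> powr (p - 1))"
      by blast
    with that show ?thesis
      by (intro exI[of _ \<xi>]) (auto simp: powr_divdiff_def field_simps)
  qed
  consider "x < y" | "y < x" | "x = y" by linarith
  then show ?thesis
  proof cases
    case 2
    with *[of y x] assms show ?thesis
      by (simp add: powr_divdiff_commute[of p y x] min.commute max.commute)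
  qed (use * assms in \<open>auto simp: powr_divdiff_def\<close>)
qed

text \<open>At a diagonal point the intermediate value is squeezed between the two coordinates;
  elsewhere the quotient formula holds in a neighbourhood.\<close>

lemma continuous_on_powr_divdiff: "continuous_on ({0<..} \<times> {0<..}) (powr_divdiff p)"
proof (rule continuous_at_imp_continuous_on, rule ballI)
  fix x :: "real \<times> real" assume x: "x \<in> {0<..} \<times> {0<..}"
  have fst: "(fst \<longlongrightarrow> fst x) (at x)" and snd: "(snd \<longlongrightarrow> snd x) (at x)"
    by (auto intro!: tendsto_intros)
  have ev_pos: "\<forall>\<^sub>F y in at x. 0 < fst y \<and> 0 < snd y"
    using order_tendstoD(1)[OF fst, of 0] order_tendstoD(1)[OF snd, of 0] x
    by (auto simp: eventually_conj_iff mem_Times_iff)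
  show "isCont (powr_divdiff p) x"
  proof (cases "fst x = snd x")
    case True
    \<comment> \<open>The implication makes the choice of \<open>\<xi>\<close> total; outside the
      positive quadrant its value is arbitrary.\<close>
    have "\<forall>y. \<exists>\<xi>. 0 < fst y \<and> 0 < snd y \<longrightarrow> min (fst y) (snd y) \<le> \<xi> \<and> \<xi> \<le> max (fst y) (snd y)
        \<and> powr_divdiff p y = p * \<xi> powr (p - 1)"
      using powr_divdiff_mean_value[of "fst _" "snd _"] by auto
    then obtain \<xi> where \<xi>: "\<And>y. 0 < fst y \<Longrightarrow> 0 < snd y \<Longrightarrow> min (fst y) (snd y) \<le> \<xi> y \<and>
        \<xi> y \<le> max (fst y) (snd y) \<and> powr_divdiff p y = p * \<xi> y powr (p - 1)"
      by metis
    have "((\<lambda>y. min (fst y) (snd y)) \<longlongrightarrow> fst x) (at x)"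
      using tendsto_min[OF fst snd] True by simp
    moreover have "((\<lambda>y. max (fst y) (snd y)) \<longlongrightarrow> fst x) (at x)"
      using tendsto_max[OF fst snd] True by simp
    ultimately have "(\<xi> \<longlongrightarrow> fst x) (at x)"
      by (rule tendsto_sandwich[rotated 2]) (use ev_pos \<xi> in \<open>auto elim!: eventually_mono\<close>)
    then have "((\<lambda>y. p * \<xi> y powr (p - 1)) \<longlongrightarrow> p * fst x powr (p - 1)) (at x)"
      using x by (intro tendsto_intros) auto
    moreover have "\<forall>\<^sub>F y in at x. p * \<xi> y powr (p - 1) = powr_divdiff p y"
      using ev_pos by eventually_elim (use \<xi> in auto)
    ultimately show ?thesis
      using True by (simp add: isCont_def powr_divdiff_def[of p x] tendsto_cong)
  next
    case False
    have "((\<lambda>y. (fst y powr p - snd y powr p) / (fst y - snd y)) \<longlongrightarrow>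
        (fst x powr p - snd x powr p) / (fst x - snd x)) (at x)"
      using x False by (intro tendsto_intros fst snd) auto
    moreover have "\<forall>\<^sub>F y in at x. fst y - snd y \<noteq> 0"
      using tendsto_diff[OF fst snd] by (rule tendsto_imp_eventually_ne) (use False in simp)
    then have "\<forall>\<^sub>F y in at x. (fst y powr p - snd y powr p) / (fst y - snd y) = powr_divdiff p y"
      by eventually_elim (simp add: powr_divdiff_def)
    ultimately show ?thesis
      using False by (simp add: isCont_def powr_divdiff_def[of p x] tendsto_cong)
  qed
qed

section \<open>Derivatives of powers along curves\<close>

text \<open>An exact formula without remainder, also for noncommuting matrices: multiplying the
  divided difference by \<open>fst x - snd x\<close> gives the difference of powers, and on the
  diagonal both vanish.\<close>

lemma op_powr_diff:
  fixes A B :: "complex^'n^'n"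
  assumes "hermitian A" "hermitian B"
  shows "op_powr A p - op_powr B p = double_op_sum (powr_divdiff p) A B (A - B)"
proof -
  have "A - B = double_op_sum (\<lambda>x. fst x - snd x) A B (mat 1)"
    by (simp add: double_op_sum_diff double_op_sum_fst double_op_sum_snd assms)
  then have "double_op_sum (powr_divdiff p) A B (A - B)
      = double_op_sum (\<lambda>x. powr_divdiff p x * (fst x - snd x)) A B (mat 1)"
    by (simp add: double_op_sum_mult assms)
  also have "\<dots> = double_op_sum (\<lambda>x. fst x powr p - snd x powr p) A B (mat 1)"
    by (intro double_op_sum_cong) (simp add: powr_divdiff_def)
  also have "\<dots> = op_powr A p - op_powr B p"
    using op_powr_mult_left[OF assms, of p "mat 1"] op_powr_mult_right[OF assms, of "mat 1" p]
    by (simp add: double_op_sum_diff)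
  finally show ?thesis ..
qed

lemma has_vector_derivative_iff_tendsto:
  "(f has_vector_derivative D) (at t) \<longleftrightarrow>
    ((\<lambda>s. (f s - f t) /\<^sub>R (s - t)) \<longlongrightarrow> D) (at t)"
proof -
  have "(f has_vector_derivative D) (at t) \<longleftrightarrow>
      ((\<lambda>s. (f s - f t - (s - t) *\<^sub>R D) /\<^sub>R norm (s - t)) \<longlongrightarrow> 0) (at t)"
    by (simp add: has_vector_derivative_def has_derivative_at_within bounded_linear_scaleR_left)
  also have "\<dots> \<longleftrightarrow> ((\<lambda>s. norm ((f s - f t - (s - t) *\<^sub>R D) /\<^sub>R norm (s - t))) \<longlongrightarrow> 0) (at t)"
    by (rule tendsto_norm_zero_iff[symmetric])
  also have "\<dots> \<longleftrightarrow> ((\<lambda>s. norm ((f s - f t) /\<^sub>R (s - t) - D)) \<longlongrightarrow> 0) (at t)"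
  proof (intro tendsto_cong)
    have "norm ((f s - f t - (s - t) *\<^sub>R D) /\<^sub>R norm (s - t)) = norm ((f s - f t) /\<^sub>R (s - t) - D)"
      if "s \<noteq> t" for s
    proof -
      have "(f s - f t) /\<^sub>R (s - t) - D = (f s - f t - (s - t) *\<^sub>R D) /\<^sub>R (s - t)"
        using that by (simp add: scaleR_diff_right)
      then show ?thesis by simp
    qed
    then show "\<forall>\<^sub>F s in at t. norm ((f s - f t - (s - t) *\<^sub>R D) /\<^sub>R norm (s - t))
        = norm ((f s - f t) /\<^sub>R (s - t) - D)"
      by (auto simp: eventually_at_filter)
  qed
  also have "\<dots> \<longleftrightarrow> ((\<lambda>s. (f s - f t) /\<^sub>R (s - t)) \<longlongrightarrow> D) (at t)"
    by (simp add: tendsto_norm_zero_iff LIM_zero_iff)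
  finally show ?thesis .
qed

text \<open>Dividing the exact difference formula by \<open>s - t\<close> turns the claim into joint
  continuity of the double operator sum.\<close>

lemma has_vector_derivative_op_powr:
  fixes A :: "real \<Rightarrow> complex^'n^'n"
  assumes A: "(A has_vector_derivative A') (at t)" and pos: "\<And>t. pos_def (A t)"
  shows "((\<lambda>s. op_powr (A s) p) has_vector_derivative
    double_op_sum (powr_divdiff p) (A t) (A t) A') (at t)"
proof -
  have "(A \<longlongrightarrow> A t) (at t)"
    using has_vector_derivative_continuous[OF A] by (simp add: isCont_def)
  moreover have "((\<lambda>s. (A s - A t) /\<^sub>R (s - t)) \<longlongrightarrow> A') (at t)"
    using A by (simp add: has_vector_derivative_iff_tendsto)
  ultimately have "((\<lambda>s. double_op_sum (powr_divdiff p) (A s) (A t) ((A s - A t) /\<^sub>R (s - t)))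
      \<longlongrightarrow> double_op_sum (powr_divdiff p) (A t) (A t) A') (at t)"
    by (intro tendsto_double_op_sum continuous_on_powr_divdiff)
      (auto intro: pos pos_def_hermitian)
  then show ?thesis
    by (simp add: has_vector_derivative_iff_tendsto op_powr_diff pos pos_def_hermitian
        double_op_sum_scaleR_arg)
qed

text \<open>Under the trace, a function of \<open>A\<close> sees only diagonal blocks, since the
  off-diagonal blocks of the identity vanish. There the divided difference is the derivative of the
  power.\<close>

lemma trace_op_powr_mult_double_op_sum:
  fixes A :: "complex^'n^'n"
  assumes A: "hermitian A"
  shows "trace (op_powr A q ** double_op_sum (powr_divdiff p) A A H)
    = p *\<^sub>R trace (op_powr A (q + p - 1) ** H)"
proof -
  let ?E = "eigenprojection A"
  have "trace (op_powr A q ** double_op_sum (powr_divdiff p) A A H)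
    = trace (double_op_sum (\<lambda>x. fst x powr q) A A (mat 1) ** double_op_sum (powr_divdiff p) A A H)"
    by (simp flip: op_powr_mult_left[OF A A])
  also have "\<dots> = trace (double_op_sum (\<lambda>x. p * fst x powr (q + p - 1)) A A (mat 1)
      ** double_op_sum (\<lambda>x. 1) A A H)"
    unfolding trace_double_op_sum_mult[OF A]
  proof (intro sum.cong refl)
    fix c d
    show "complex_of_real (fst (c, d) powr q * powr_divdiff p (d, c)) *
         trace (?E c ** mat 1 ** ?E d ** H) =
         complex_of_real (p * fst (c, d) powr (q + p - 1) * 1) * trace (?E c ** mat 1 ** ?E d ** H)"
    proof (cases "c = d")
      case False
      then show ?thesis by (simp add: eigenprojection_orthogonal A mm.zero_left trace_def)
    next
      case True
      have "d powr q * powr_divdiff p (d, d) = p * d powr (q + p - 1)"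
        by (simp add: powr_divdiff_def add_diff_eq flip: powr_add)
      then show ?thesis by (simp only: True fst_conv mult_1_right)
    qed
  qed
  also have "\<dots> = p *\<^sub>R trace (op_powr A (q + p - 1) ** H)"
    by (simp add: double_op_sum_one A double_op_sum_scale mm.scaleR_left trace_scaleR
        flip: op_powr_mult_left[OF A A])
  finally show ?thesis .
qed

section \<open>The divergence\<close>

lemma op_powr_zero:
  fixes A :: "complex^'n^'n"
  assumes "pos_def A"
  shows "op_powr A 0 = mat 1"
proof -
  \<comment> \<open>Positivity matters here, since \<open>0 powr 0 = 0\<close>.\<close>
  have "op_powr A 0 = (\<Sum>c\<in>eigenvalues A. eigenprojection A c)"
    unfolding op_powr_def
    by (intro sum.cong refl) (use pos_def_eigenvalue_pos[OF assms] in force)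
  then show ?thesis by (simp add: sum_eigenprojection pos_def_hermitian assms)
qed

lemma has_vector_derivative_trace_op_powr:
  fixes A :: "real \<Rightarrow> complex^'n^'n"
  assumes A: "(A has_vector_derivative A') (at t)" and pos: "\<And>t. pos_def (A t)"
  shows "((\<lambda>s. trace (op_powr (A s) p)) has_vector_derivative
    p *\<^sub>R trace (op_powr (A t) (p - 1) ** A')) (at t)"
proof -
  have "((\<lambda>s. trace (op_powr (A s) p)) has_vector_derivative
      trace (double_op_sum (powr_divdiff p) (A t) (A t) A')) (at t)"
    by (rule bounded_linear.has_vector_derivative[OF bounded_linear_trace])
      (rule has_vector_derivative_op_powr[OF A pos])
  then show ?thesis
    using trace_op_powr_mult_double_op_sum[OF pos_def_hermitian[OF pos[of t]], of 0 p A']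
    by (simp add: op_powr_zero pos)
qed

section \<open>First derivative of the divergence\<close>

definition renyi_core :: "real \<Rightarrow> real \<Rightarrow> complex^'n^'n \<Rightarrow> complex^'n^'n \<Rightarrow> complex^'n^'n"
  where "renyi_core \<alpha> z \<rho> \<sigma> =
    op_powr \<sigma> ((1 - \<alpha>) / (2 * z)) ** op_powr \<rho> (\<alpha> / z) ** op_powr \<sigma> ((1 - \<alpha>) / (2 * z))"

text \<open>The gradient of the trace functional with respect to \<open>\<sigma> powr p\<close>, where \<open>p = (1 - \<alpha>) / (2 * z)\<close>.
  The subtracted term does not contribute along curves of constant trace; it makes the weight
  vanish at \<open>\<sigma> = \<rho>\<close>, so that no second derivative of the functional calculus is needed.\<close>

definition renyi_weight :: "real \<Rightarrow> real \<Rightarrow> complex^'n^'n \<Rightarrow> complex^'n^'n \<Rightarrow> complex^'n^'n"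
  where "renyi_weight \<alpha> z \<rho> \<sigma> =
    op_powr \<rho> (\<alpha> / z) ** op_powr \<sigma> ((1 - \<alpha>) / (2 * z)) ** op_powr (renyi_core \<alpha> z \<rho> \<sigma>) (z - 1)
    + op_powr (renyi_core \<alpha> z \<rho> \<sigma>) (z - 1) ** op_powr \<sigma> ((1 - \<alpha>) / (2 * z)) ** op_powr \<rho> (\<alpha> / z)
    - 2 *\<^sub>R op_powr \<sigma> (1 - (1 - \<alpha>) / (2 * z))"

lemma renyi_div_eq_core:
  "renyi_div \<alpha> z \<rho> \<sigma> = 1 / (\<alpha> - 1) * ln (Re (trace (op_powr (renyi_core \<alpha> z \<rho> \<sigma>) z)))"
  by (simp add: renyi_div_def renyi_core_def)

lemma pos_def_renyi_core: "pos_def \<rho> \<Longrightarrow> pos_def \<sigma> \<Longrightarrow> pos_def (renyi_core \<alpha> z \<rho> \<sigma>)"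
  unfolding renyi_core_def by (intro pos_def_congruence pos_def_op_powr)

lemma renyi_core_same:
  assumes "pos_def \<rho>" "z \<noteq> 0"
  shows "renyi_core \<alpha> z \<rho> \<rho> = op_powr \<rho> (1 / z)"
proof -
  have "(1 - \<alpha>) / (2 * z) + \<alpha> / z + (1 - \<alpha>) / (2 * z) = 1 / z"
    using assms by (simp add: field_simps)
  then show ?thesis
    using assms by (simp add: renyi_core_def op_powr_add pos_def_hermitian)
qed

lemma renyi_core_powr_same:
  assumes "pos_def \<rho>" "z \<noteq> 0"
  shows "op_powr (renyi_core \<alpha> z \<rho> \<rho>) (z - 1) = op_powr \<rho> (1 - 1 / z)"
  using assms by (simp add: renyi_core_same op_powr_op_powr diff_divide_distrib)

text \<open>At equal arguments each product collapses to the power with exponent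
  \<open>1 - (1 - \<alpha>) / (2 * z)\<close>, and the subtracted term cancels both.\<close>

lemma renyi_weight_same:
  assumes "pos_def \<rho>" "z \<noteq> 0"
  shows "renyi_weight \<alpha> z \<rho> \<rho> = 0"
proof -
  have *: "\<alpha> / z + (1 - \<alpha>) / (2 * z) + (1 - 1 / z) = 1 - (1 - \<alpha>) / (2 * z)"
    "(1 - 1 / z) + (1 - \<alpha>) / (2 * z) + \<alpha> / z = 1 - (1 - \<alpha>) / (2 * z)"
    using assms by (simp_all add: field_simps)
  show ?thesis
    unfolding renyi_weight_def renyi_core_powr_same[OF assms] op_powr_add[OF pos_def_hermitian[OF assms(1)]] *
    by (simp add: scaleR_2)
qed

lemma has_vector_derivative_renyi_core:
  fixes \<sigma> :: "real \<Rightarrow> complex^'n^'n" and \<alpha> z t :: real and \<sigma>' :: "complex^'n^'n"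
  assumes "(\<sigma> has_vector_derivative \<sigma>') (at t)" and "\<And>s. pos_def (\<sigma> s)"
  defines "S' \<equiv> double_op_sum (powr_divdiff ((1 - \<alpha>) / (2 * z))) (\<sigma> t) (\<sigma> t) \<sigma>'"
  shows "((\<lambda>s. renyi_core \<alpha> z \<rho> (\<sigma> s)) has_vector_derivative
    op_powr (\<sigma> t) ((1 - \<alpha>) / (2 * z)) ** op_powr \<rho> (\<alpha> / z) ** S'
    + S' ** op_powr \<rho> (\<alpha> / z) ** op_powr (\<sigma> t) ((1 - \<alpha>) / (2 * z))) (at t)"
proof -
  have S: "((\<lambda>s. op_powr (\<sigma> s) ((1 - \<alpha>) / (2 * z))) has_vector_derivative S') (at t)"
    unfolding S'_def by (rule has_vector_derivative_op_powr) fact+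
  show ?thesis
    unfolding renyi_core_def
    using mm.has_vector_derivative[OF mm.has_vector_derivative[OF S has_vector_derivative_const[of "op_powr \<rho> (\<alpha> / z)"]] S]
    by (simp add: mm.zero_right)
qed

text \<open>The chain rule through the logarithm and the trace of a power leaves the derivative of
  the core, in which the derivative \<open>S'\<close> of the power of \<open>\<sigma>\<close> occurs
  twice; cyclicity collects both occurrences.\<close>

lemma has_vector_derivative_renyi_div:
  fixes \<sigma> :: "real \<Rightarrow> complex^'n^'n"
  assumes \<sigma>: "(\<sigma> has_vector_derivative \<sigma>') (at t)" and pos: "\<And>s. pos_def (\<sigma> s)"
    and \<rho>: "pos_def \<rho>" and tr: "trace \<sigma>' = 0"
  shows "((\<lambda>s. renyi_div \<alpha> z \<rho> (\<sigma> s)) has_vector_derivative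
    z / (\<alpha> - 1) * Re (trace (renyi_weight \<alpha> z \<rho> (\<sigma> t) **
      double_op_sum (powr_divdiff ((1 - \<alpha>) / (2 * z))) (\<sigma> t) (\<sigma> t) \<sigma>'))
    / Re (trace (op_powr (renyi_core \<alpha> z \<rho> (\<sigma> t)) z))) (at t)"
proof -
  define p where "p = (1 - \<alpha>) / (2 * z)"
  define S where "S = op_powr (\<sigma> t) p"
  define R where "R = op_powr \<rho> (\<alpha> / z)"
  define S' where "S' = double_op_sum (powr_divdiff p) (\<sigma> t) (\<sigma> t) \<sigma>'"
  define N where "N = op_powr (renyi_core \<alpha> z \<rho> (\<sigma> t)) (z - 1)"
  define Q where "Q = (\<lambda>s. Re (trace (op_powr (renyi_core \<alpha> z \<rho> (\<sigma> s)) z)))"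
  have Qpos: "0 < Q s" for s
    unfolding Q_def by (intro pos_def_trace_pos pos_def_op_powr pos_def_renyi_core \<rho> pos)
  \<comment> \<open>The pairing of the subtracted term with \<open>S'\<close> is a multiple of
    \<open>trace \<sigma>'\<close>, so it adds nothing.\<close>
  have "trace (op_powr (\<sigma> t) (1 - p) ** S') = p *\<^sub>R trace (op_powr (\<sigma> t) (1 - p + p - 1) ** \<sigma>')"
    unfolding S'_def by (rule trace_op_powr_mult_double_op_sum[OF pos_def_hermitian[OF pos]])
  then have z0: "trace (op_powr (\<sigma> t) (1 - p) ** S') = 0"
    by (simp add: op_powr_zero pos tr)
  have "trace (N ** (S ** R ** S' + S' ** R ** S)) = trace (N ** S ** R ** S') + trace ((N ** S') ** (R ** S))"
    by (simp add: mm.add_right trace_add matrix_mul_assoc)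
  \<comment> \<open>Rotation puts \<open>S'\<close> last, as in the first summand.\<close>
  also have "trace ((N ** S') ** (R ** S)) = trace ((R ** S) ** (N ** S'))"
    by (rule trace_mul_sym)
  also have "trace (N ** S ** R ** S') + trace ((R ** S) ** (N ** S'))
      = trace (renyi_weight \<alpha> z \<rho> (\<sigma> t) ** S')"
    unfolding renyi_weight_def
    by (simp add: mm.add_left mm.diff_left mm.scaleR_left trace_add trace_sub trace_scaleR z0
        matrix_mul_assoc flip: p_def S_def R_def N_def)
  finally have W: "trace (N ** (S ** R ** S' + S' ** R ** S)) = trace (renyi_weight \<alpha> z \<rho> (\<sigma> t) ** S')" .
  have "((\<lambda>s. trace (op_powr (renyi_core \<alpha> z \<rho> (\<sigma> s)) z)) has_vector_derivative
      z *\<^sub>R trace (renyi_weight \<alpha> z \<rho> (\<sigma> t) ** S')) (at t)"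
    unfolding W[symmetric] unfolding N_def S_def R_def S'_def p_def
    by (intro has_vector_derivative_trace_op_powr has_vector_derivative_renyi_core \<sigma> pos
        pos_def_renyi_core \<rho>)
  from bounded_linear.has_vector_derivative[OF bounded_linear_Re this]
  have "(Q has_real_derivative z * Re (trace (renyi_weight \<alpha> z \<rho> (\<sigma> t) ** S'))) (at t)"
    by (simp add: Q_def has_real_derivative_iff_has_vector_derivative)
  from DERIV_ln_divide[THEN DERIV_chain2, OF Qpos this]
  have "((\<lambda>s. 1 / (\<alpha> - 1) * ln (Q s)) has_real_derivative
      1 / (\<alpha> - 1) * (1 / Q t * (z * Re (trace (renyi_weight \<alpha> z \<rho> (\<sigma> t) ** S'))))) (at t)"
    by (rule DERIV_cmult)
  then show ?thesis
    by (simp add: has_real_derivative_iff_has_vector_derivative renyi_div_eq_core Q_def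
        flip: S'_def p_def)
qed

section \<open>Derivative of the weight and its symbol\<close>

text \<open>The symbol of the derivative of \<open>renyi_weight\<close> at equal arguments:
  \<open>s\<close> belongs to the power of \<open>\<sigma>\<close> and \<open>w\<close> to that of
  the core. Left factors become powers of the first variable, right factors powers of the second,
  nested as the multiplication rules produce them.\<close>

definition renyi_weight_symbol :: "real \<Rightarrow> real \<Rightarrow> real \<times> real \<Rightarrow> real"
  where "renyi_weight_symbol \<alpha> z x = (let
      p = (1 - \<alpha>) / (2 * z); q = \<alpha> / z; n = 1 - 1 / z;
      s = powr_divdiff p x;
      w = powr_divdiff (z - 1) (fst x powr (1 / z), snd x powr (1 / z)) *
        (fst x powr p * (fst x powr q * s) + snd x powr p * (snd x powr q * s))
    in (fst x powr q * (fst x powr p * w) + snd x powr n * (fst x powr q * s))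
      + (snd x powr q * (fst x powr n * s) + snd x powr q * (snd x powr p * w))
      - 2 * powr_divdiff (1 - p) x)"

lemma renyi_weight_symbol_commute:
  "renyi_weight_symbol \<alpha> z (y, x) = renyi_weight_symbol \<alpha> z (x, y)"
  unfolding renyi_weight_symbol_def Let_def fst_conv snd_conv
    powr_divdiff_commute[of _ y x] powr_divdiff_commute[of _ "y powr _" "x powr _"]
  by (simp add: algebra_simps)

lemma op_powr_mult_double_op_sum:
  assumes "hermitian A"
  shows "op_powr A p ** double_op_sum \<phi> A A X = double_op_sum (\<lambda>x. fst x powr p * \<phi> x) A A X"
  by (simp only: op_powr_mult_left[OF assms assms] double_op_sum_mult[OF assms assms])

lemma double_op_sum_mult_op_powr:
  assumes "hermitian A"
  shows "double_op_sum \<phi> A A X ** op_powr A p = double_op_sum (\<lambda>x. snd x powr p * \<phi> x) A A X"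
  by (simp only: op_powr_mult_right[OF assms assms] double_op_sum_mult[OF assms assms])

text \<open>The reference state is the value of the curve at \<open>t\<close>, so there all factors
  are powers of one matrix and every term of the product rule is a double operator sum over
  it.\<close>

lemma has_vector_derivative_renyi_weight:
  fixes \<sigma> :: "real \<Rightarrow> complex^'n^'n"
  assumes \<sigma>: "(\<sigma> has_vector_derivative H) (at t)" and pos: "\<And>s. pos_def (\<sigma> s)" and z: "z \<noteq> 0"
  shows "((\<lambda>s. renyi_weight \<alpha> z (\<sigma> t) (\<sigma> s)) has_vector_derivative
    double_op_sum (renyi_weight_symbol \<alpha> z) (\<sigma> t) (\<sigma> t) H) (at t)"
proof -
  define p where "p = (1 - \<alpha>) / (2 * z)"
  define q where "q = \<alpha> / z"
  define n where "n = 1 - 1 / z"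
  define A where "A = \<sigma> t"
  have A: "pos_def A" "hermitian A" using pos by (simp_all add: A_def pos_def_hermitian)
  define s where "s = powr_divdiff p"
  define m where "m = (\<lambda>x. fst x powr p * (fst x powr q * s x) + snd x powr p * (snd x powr q * s x))"
  define w where "w = (\<lambda>x. powr_divdiff (z - 1) (fst x powr (1 / z), snd x powr (1 / z)) * m x)"
  note ops = op_powr_mult_double_op_sum[OF A(2)] double_op_sum_mult_op_powr[OF A(2)]
  have S: "((\<lambda>s. op_powr (\<sigma> s) p) has_vector_derivative double_op_sum s A A H) (at t)"
    unfolding s_def A_def by (intro has_vector_derivative_op_powr \<sigma> pos)
  have U: "((\<lambda>s. op_powr (\<sigma> s) (1 - p)) has_vector_derivative
      double_op_sum (powr_divdiff (1 - p)) A A H) (at t)"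
    unfolding A_def by (intro has_vector_derivative_op_powr \<sigma> pos)
  have "((\<lambda>s. renyi_core \<alpha> z A (\<sigma> s)) has_vector_derivative
      op_powr A p ** op_powr A q ** double_op_sum s A A H
      + double_op_sum s A A H ** op_powr A q ** op_powr A p) (at t)"
    using has_vector_derivative_renyi_core[OF \<sigma> pos, where \<rho> = A and \<alpha> = \<alpha> and z = z]
    by (simp only: A_def p_def q_def s_def)
  also have "op_powr A p ** op_powr A q ** double_op_sum s A A H
      + double_op_sum s A A H ** op_powr A q ** op_powr A p = double_op_sum m A A H"
    by (simp only: matrix_mul_assoc[symmetric, of "op_powr A p"] ops m_def double_op_sum_add)
  finally have "((\<lambda>s. op_powr (renyi_core \<alpha> z A (\<sigma> s)) (z - 1)) has_vector_derivative
      double_op_sum (powr_divdiff (z - 1)) (renyi_core \<alpha> z A (\<sigma> t)) (renyi_core \<alpha> z A (\<sigma> t))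
        (double_op_sum m A A H)) (at t)"
    by (rule has_vector_derivative_op_powr) (intro pos_def_renyi_core A pos)
  \<comment> \<open>The core at \<open>A\<close> is \<open>op_powr A (1 / z)\<close>, which explains
    the arguments in \<open>w\<close>; composition with the sum for \<open>m\<close> multiplies the
    symbols.\<close>
  also have "double_op_sum (powr_divdiff (z - 1)) (renyi_core \<alpha> z A (\<sigma> t)) (renyi_core \<alpha> z A (\<sigma> t))
        (double_op_sum m A A H) = double_op_sum w A A H"
    using A z
    by (simp add: renyi_core_same double_op_sum_op_powr w_def double_op_sum_mult flip: A_def)
  finally have N: "((\<lambda>s. op_powr (renyi_core \<alpha> z A (\<sigma> s)) (z - 1)) has_vector_derivative
      double_op_sum w A A H) (at t)" .
  have Nt: "op_powr (renyi_core \<alpha> z A A) (z - 1) = op_powr A n"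
    using A z by (simp add: renyi_core_powr_same n_def)
  have "((\<lambda>s. op_powr A q ** op_powr (\<sigma> s) p ** op_powr (renyi_core \<alpha> z A (\<sigma> s)) (z - 1))
      has_vector_derivative op_powr A q ** op_powr A p ** double_op_sum w A A H
      + op_powr A q ** double_op_sum s A A H ** op_powr A n) (at t)"
    using mm.has_vector_derivative[OF mm.has_vector_derivative[OF
          has_vector_derivative_const[of "op_powr A q"] S] N]
    by (simp add: mm.zero_left Nt flip: A_def)
  moreover have "((\<lambda>s. op_powr (renyi_core \<alpha> z A (\<sigma> s)) (z - 1) ** op_powr (\<sigma> s) p ** op_powr A q)
      has_vector_derivative (op_powr A n ** double_op_sum s A A H
      + double_op_sum w A A H ** op_powr A p) ** op_powr A q) (at t)"
    using mm.has_vector_derivative[OF mm.has_vector_derivative[OF N S]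
          has_vector_derivative_const[of "op_powr A q"]]
    by (simp add: mm.zero_right Nt flip: A_def)
  ultimately have "((\<lambda>s. renyi_weight \<alpha> z A (\<sigma> s)) has_vector_derivative
      (op_powr A q ** op_powr A p ** double_op_sum w A A H
      + op_powr A q ** double_op_sum s A A H ** op_powr A n)
      + (op_powr A n ** double_op_sum s A A H + double_op_sum w A A H ** op_powr A p) ** op_powr A q
      - 2 *\<^sub>R double_op_sum (powr_divdiff (1 - p)) A A H) (at t)"
    unfolding renyi_weight_def p_def[symmetric] q_def[symmetric]
    by (intro has_vector_derivative_diff has_vector_derivative_add
        bounded_linear.has_vector_derivative[OF bounded_linear_scaleR_right] U)
  also have "(op_powr A q ** op_powr A p ** double_op_sum w A A H
      + op_powr A q ** double_op_sum s A A H ** op_powr A n)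
      + (op_powr A n ** double_op_sum s A A H + double_op_sum w A A H ** op_powr A p) ** op_powr A q
      - 2 *\<^sub>R double_op_sum (powr_divdiff (1 - p)) A A H
      = double_op_sum (renyi_weight_symbol \<alpha> z) A A H"
    unfolding renyi_weight_symbol_def[abs_def] Let_def p_def[symmetric] q_def[symmetric] n_def[symmetric]
      s_def[symmetric]
    by (simp only: matrix_mul_assoc[symmetric, of "op_powr A q" "op_powr A p"] ops mm.add_left w_def m_def
        double_op_sum_add double_op_sum_diff double_op_sum_scale)
  finally show ?thesis by (simp only: A_def)
qed

section \<open>Comparison with the zeta function\<close>

text \<open>With \<open>p = (1 - \<alpha>) / (2 * z)\<close>, the letters \<open>a\<close>,
  \<open>b\<close> stand for the powers of \<open>x\<close>, \<open>y\<close> with exponent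
  \<open>p\<close>, and \<open>X\<close>, \<open>Y\<close> for those with exponent
  \<open>1 / z\<close>. All other powers are rational in these, so clearing denominators
  suffices.\<close>

lemma symbol_identity:
  fixes a b x y X Y :: real
  assumes "a \<noteq> 0" "b \<noteq> 0" "X \<noteq> 0" "Y \<noteq> 0" "x \<noteq> y" "X \<noteq> Y"
  defines "s \<equiv> (a - b) / (x - y)"
  defines "w \<equiv> (x / X - y / Y) / (X - Y) * (X / a * s + Y / b * s)"
  shows "s * (X / a * w + y / Y * (X / (a * a) * s)
        + (Y / (b * b) * (x / X * s) + Y / b * w) - 2 * ((x / a - y / b) / (x - y)))
      = - ((a * a - b * b) / (x - y) * ((X / (a * a) - Y / (b * b)) / (X - Y)))"
proof -
  have "x - y \<noteq> 0" "X - Y \<noteq> 0" using assms by auto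
  then show ?thesis
    unfolding s_def w_def using assms(1-4)
    by (simp add: divide_simps) (simp add: algebra_simps)
qed

lemma zeta_fun_eq_symbol:
  assumes x: "0 < x" and y: "0 < y" and z: "0 < z" and \<alpha>: "\<alpha> \<noteq> 0" "\<alpha> \<noteq> 1"
  shows "z / (\<alpha> * (\<alpha> - 1)) * (renyi_weight_symbol \<alpha> z (x, y) * powr_divdiff ((1 - \<alpha>) / (2 * z)) (y, x))
    = zeta_fun \<alpha> z x y"
proof -
  define p where "p = (1 - \<alpha>) / (2 * z)"
  \<comment> \<open>All exponents are reduced to \<open>p\<close>, \<open>1 / z\<close> and
    \<open>1\<close>.\<close>
  have q: "\<alpha> / z = 1 / z - p - p" and dp: "(1 - \<alpha>) / z = p + p"
    using z by (simp_all add: p_def field_simps)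
  define a b X Y where "a = x powr p" and "b = y powr p" and "X = x powr (1 / z)" and "Y = y powr (1 / z)"
  have pos: "0 < a" "0 < b" "0 < X" "0 < Y"
    using x y by (simp_all add: a_def b_def X_def Y_def)
  have pw: "x powr (1 - 1 / z) = x / X" "y powr (1 - 1 / z) = y / Y"
    "x powr (1 - p) = x / a" "y powr (1 - p) = y / b"
    "X powr (z - 1) = x / X" "Y powr (z - 1) = y / Y"
    using x y z by (simp_all add: a_def b_def X_def Y_def powr_diff powr_powr)
  have pw2: "x powr (p + p) = a * a" "y powr (p + p) = b * b"
    "x powr (1 / z - p - p) = X / (a * a)" "y powr (1 / z - p - p) = Y / (b * b)"
    by (simp_all only: a_def b_def X_def Y_def powr_add powr_diff divide_divide_eq_left)
  show ?thesis
  proof (cases "x = y")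
    case False
    \<comment> \<open>Injectivity of the power selects the quotient branch for the divided
      difference at \<open>(X, Y)\<close> as well.\<close>
    have XY: "X \<noteq> Y"
      using False powr_base_inj[OF x y, of "1 / z"] z by (auto simp: X_def Y_def)
    define s where "s = (a - b) / (x - y)"
    define w where "w = (x / X - y / Y) / (X - Y) * (X / a * s + Y / b * s)"
    have om: "renyi_weight_symbol \<alpha> z (x, y) = X / a * w + y / Y * (X / (a * a) * s)
        + (Y / (b * b) * (x / X * s) + Y / b * w) - 2 * ((x / a - y / b) / (x - y))"
      unfolding renyi_weight_symbol_def Let_def p_def[symmetric] q fst_conv snd_conv pw pw2
        powr_divdiff_def if_not_P[OF False] if_not_P[OF XY] a_def[symmetric] b_def[symmetric]
        X_def[symmetric] Y_def[symmetric] s_def[symmetric] w_def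
      using pos by simp
    have "s * (X / a * w + y / Y * (X / (a * a) * s)
        + (Y / (b * b) * (x / X * s) + Y / b * w) - 2 * ((x / a - y / b) / (x - y)))
      = - ((a * a - b * b) / (x - y) * ((X / (a * a) - Y / (b * b)) / (X - Y)))"
      by (rule symbol_identity[of a b X Y x y, folded s_def, folded w_def])
        (use pos False XY in auto)
    then have "renyi_weight_symbol \<alpha> z (x, y) * powr_divdiff p (y, x)
      = - ((a * a - b * b) / (x - y) * ((X / (a * a) - Y / (b * b)) / (X - Y)))"
      unfolding om powr_divdiff_commute[of p y x] using False
      by (simp add: powr_divdiff_def s_def a_def b_def mult.commute)
    \<comment> \<open>The factor \<open>\<alpha> - 1\<close> of the divergence absorbs the minus
      sign of the rational identity.\<close>
    moreover have "z / (\<alpha> * (\<alpha> - 1)) = - (z / (\<alpha> * (1 - \<alpha>)))"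
      by (metis minus_diff_eq minus_divide_right mult_minus_right)
    ultimately show ?thesis
      unfolding p_def[symmetric] zeta_fun_def if_not_P[OF False] q dp pw2 X_def[symmetric] Y_def[symmetric]
      by simp
  next
    case True
    have dd: "powr_divdiff p (x, x) = p * a / x" "powr_divdiff (1 - p) (x, x) = (1 - p) / a"
      "powr_divdiff (z - 1) (X, X) = (z - 1) * (x / X / X)"
      using x pos unfolding powr_divdiff_def fst_conv snd_conv powr_diff[of X "z - 1" 1] pw(5)
      by (simp_all add: a_def powr_diff powr_minus_divide)
    have "renyi_weight_symbol \<alpha> z (x, x) * powr_divdiff p (x, x) = - (\<alpha> * (1 - \<alpha>) / z / x)"
      unfolding renyi_weight_symbol_def Let_def p_def[symmetric] q fst_conv snd_conv pw pw2 dd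
        X_def[symmetric] a_def[symmetric]
      using x z pos by (simp add: p_def field_simps)
    then show ?thesis
      using \<alpha> x z True by (simp add: zeta_fun_def p_def field_simps)
  qed
qed

section \<open>Second derivative and conclusion\<close>

text \<open>As \<open>W t = 0\<close>, the difference quotient is the same expression with
  \<open>W s\<close> divided by \<open>s - t\<close>. Hence limits of \<open>L\<close> and
  \<open>Q\<close> suffice in place of derivatives.\<close>

lemma has_vector_derivative_trace_mult_divide:
  fixes W L :: "real \<Rightarrow> complex^'n^'n" and Q :: "real \<Rightarrow> real"
  assumes W: "(W has_vector_derivative W') (at t)" "W t = 0"
    and L: "(L \<longlongrightarrow> L0) (at t)" and Q: "(Q \<longlongrightarrow> 1) (at t)"
  shows "((\<lambda>s. c * Re (trace (W s ** L s)) / Q s) has_vector_derivative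
    c * Re (trace (W' ** L0))) (at t)"
proof -
  have "((\<lambda>s. W s /\<^sub>R (s - t)) \<longlongrightarrow> W') (at t)"
    using W by (simp add: has_vector_derivative_iff_tendsto)
  then have "((\<lambda>s. c * Re (trace ((W s /\<^sub>R (s - t)) ** L s)) / Q s) \<longlongrightarrow>
      c * Re (trace (W' ** L0)) / 1) (at t)"
    by (intro tendsto_intros mm.tendsto bounded_linear.tendsto[OF bounded_linear_trace] L Q) auto
  then show ?thesis
    by (simp add: has_vector_derivative_iff_tendsto W mm.zero_left mm.scaleR_left trace_scaleR
        trace_0[unfolded mat_0] field_simps)
qed

lemma has_vector_derivative_along_axis:
  assumes "(f has_derivative f') (at (x + t *\<^sub>R axis i 1))"
  shows "((\<lambda>t. f (x + t *\<^sub>R axis i 1)) has_vector_derivative f' (axis i 1)) (at t)"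
proof -
  have "((\<lambda>t. x + t *\<^sub>R axis i 1) has_derivative (\<lambda>t. t *\<^sub>R axis i 1)) (at t)"
    by (auto intro!: derivative_eq_intros)
  from has_derivative_compose[OF this assms] show ?thesis
    using has_derivative_bounded_linear[OF assms]
    by (simp add: has_vector_derivative_def linear_simps)
qed

lemma partial_deriv_eq:
  assumes "(f has_derivative f') (at x)"
  shows "partial_deriv i f x = f' (axis i 1)"
  unfolding partial_deriv_def
  by (rule vector_derivative_at, rule has_vector_derivative_along_axis) (use assms in simp)

text \<open>Conjugate transposition is real linear and fixes the curve, so uniqueness of the
  derivative applies.\<close>

lemma hermitian_vector_derivative:
  fixes A :: "real \<Rightarrow> complex^'n^'n"
  assumes A: "(A has_vector_derivative A') (at t)" and h: "\<And>t. hermitian (A t)"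
  shows "hermitian A'"
proof -
  have "bounded_linear (ctranspose :: complex^'n^'n \<Rightarrow> complex^'n^'n)"
    unfolding linear_conv_bounded_linear [symmetric] linear_iff
    by (simp add: ctranspose_add ctranspose_scaleR)
  from bounded_linear.has_vector_derivative[OF this A]
  have "(A has_vector_derivative ctranspose A') (at t)"
    by (simp add: ctranspose_hermitian h)
  then show ?thesis
    using vector_derivative_unique_at A unfolding hermitian_iff_ctranspose by blast
qed

text \<open>Conjugation reverses the product and cyclicity restores it. This removes
  \<open>Re\<close> when the real derivative is compared with the complex traces.\<close>

lemma trace_mult_hermitian_real:
  fixes A B :: "complex^'n^'n"
  assumes "hermitian A" "hermitian B"
  shows "complex_of_real (Re (trace (A ** B))) = trace (A ** B)"
proof -
  have "cnj (trace (A ** B)) = trace (B ** A)"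
    using assms by (simp add: ctranspose_mult ctranspose_hermitian flip: trace_ctranspose)
  also have "\<dots> = trace (A ** B)" by (rule trace_mul_sym)
  finally have "cnj (trace (A ** B)) = trace (A ** B)" .
  then have "trace (A ** B) \<in> \<real>" by (simp only: Reals_cnj_iff)
  then show ?thesis by (rule of_real_Re)
qed

theorem theorem10:
  fixes \<rho> :: "real ^ 'l \<Rightarrow> complex ^ 'n ^ 'n"
    and \<theta> :: "real ^ 'l" and \<alpha> z :: real and i j :: 'l
  assumes "\<And>\<theta>. state (\<rho> \<theta>)"
    and "\<And>\<theta>. pos_def (\<rho> \<theta>)"
    and "twice_differentiable \<rho>"
    and "\<alpha> \<in> {0<..<1} \<union> {1<..}"
    and "z > 0"
  shows "complex_of_real (info_matrix \<alpha> z \<rho> \<theta> $ i $ j) =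
    (\<Sum>k\<in>eigenvalues (\<rho> \<theta>). \<Sum>l\<in>eigenvalues (\<rho> \<theta>).
      complex_of_real (zeta_fun \<alpha> z k l) *
      trace (eigenprojection (\<rho> \<theta>) k ** partial_deriv i \<rho> \<theta> **
             eigenprojection (\<rho> \<theta>) l ** partial_deriv j \<rho> \<theta>))"
proof -
  note pos = assms(2)
  have herm: "hermitian (\<rho> x)" for x by (rule pos_def_hermitian[OF pos])
  have \<alpha>: "\<alpha> \<noteq> 0" "\<alpha> \<noteq> 1" using assms(4) by auto
  obtain f' where f': "\<And>x. (\<rho> has_derivative blinfun_apply (f' x)) (at x)"
    and f'': "\<And>x. f' differentiable (at x)"
    using assms(3) unfolding twice_differentiable_def by blast
  define D where "D = (\<lambda>k x. blinfun_apply (f' x) (axis k 1))"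
  have pd: "partial_deriv k \<rho> x = D k x" for k x
    unfolding D_def by (rule partial_deriv_eq[OF f'])
  have curve: "((\<lambda>t. \<rho> (x + t *\<^sub>R axis k 1)) has_vector_derivative D k x) (at 0)" for k x
    using has_vector_derivative_along_axis[of \<rho> "blinfun_apply (f' x)" x 0 k] f'[of x]
    by (simp add: D_def)
  have hD: "hermitian (D k x)" for k x
    using curve herm by (rule hermitian_vector_derivative)
  \<comment> \<open>The constant trace of states gives traceless derivatives, as the formula with
    the shifted weight requires.\<close>
  have trD: "trace (D k x) = 0" for k x
  proof -
    have "((\<lambda>t. 1) has_vector_derivative trace (D k x)) (at 0)"
      using bounded_linear.has_vector_derivative[OF bounded_linear_trace curve[of x k]] assms(1)
      by (simp add: state_def)
    then show ?thesis
      using vector_derivative_unique_at has_vector_derivative_const by blast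
  qed
  define p where "p = (1 - \<alpha>) / (2 * z)"
  define A where "A = \<rho> \<theta>"
  have A: "pos_def A" "hermitian A" using pos herm by (simp_all add: A_def)
  define F where "F = (\<lambda>\<epsilon>. renyi_div \<alpha> z A (\<rho> (\<theta> + \<epsilon>)))"
  define L where "L = (\<lambda>x. double_op_sum (powr_divdiff p) (\<rho> x) (\<rho> x) (D j x))"
  define Q where "Q = (\<lambda>x. Re (trace (op_powr (renyi_core \<alpha> z A (\<rho> x)) z)))"
  \<comment> \<open>Needed at every \<open>\<epsilon>\<close>, because the result is differentiated
    once more.\<close>
  have first: "partial_deriv j F \<epsilon> = z / (\<alpha> - 1) *
      Re (trace (renyi_weight \<alpha> z A (\<rho> (\<theta> + \<epsilon>)) ** L (\<theta> + \<epsilon>))) / Q (\<theta> + \<epsilon>)" for \<epsilon>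
    unfolding partial_deriv_def F_def
    using has_vector_derivative_renyi_div[OF curve[of "\<theta> + \<epsilon>" j] pos A(1) trD, of \<alpha> z]
    by (intro vector_derivative_at) (simp add: L_def Q_def p_def add.assoc)
  define \<sigma> where "\<sigma> = (\<lambda>t. \<rho> (\<theta> + t *\<^sub>R axis i 1))"
  have \<sigma>0: "\<sigma> 0 = A" by (simp add: \<sigma>_def A_def)
  have \<sigma>: "(\<sigma> has_vector_derivative D i \<theta>) (at 0)"
    unfolding \<sigma>_def by (rule curve)
  have \<sigma>_pos: "pos_def (\<sigma> t)" for t unfolding \<sigma>_def by (rule pos)
  have W: "((\<lambda>t. renyi_weight \<alpha> z A (\<sigma> t)) has_vector_derivative
      double_op_sum (renyi_weight_symbol \<alpha> z) A A (D i \<theta>)) (at 0)"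
    using has_vector_derivative_renyi_weight[OF \<sigma> \<sigma>_pos, of z \<alpha>] assms(5) by (simp add: \<sigma>0)
  have W0: "renyi_weight \<alpha> z A (\<sigma> 0) = 0"
    unfolding \<sigma>0 using A(1) assms(5) by (intro renyi_weight_same) auto
  \<comment> \<open>Differentiability of \<open>f'\<close> enters through its continuity, which
    gives the limit of the partial derivative in direction \<open>j\<close>.\<close>
  have "isCont (\<lambda>t. \<theta> + t *\<^sub>R axis i 1) (0::real)"
    by (intro continuous_intros)
  from isCont_o2[OF this differentiable_imp_continuous_within[OF f'']]
  have "isCont (\<lambda>t. f' (\<theta> + t *\<^sub>R axis i 1)) 0" .
  from bounded_linear.isCont[OF blinfun.bounded_linear_left this]
  have "isCont (\<lambda>t. D j (\<theta> + t *\<^sub>R axis i 1)) 0"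
    unfolding D_def .
  then have Dlim: "((\<lambda>t. D j (\<theta> + t *\<^sub>R axis i 1)) \<longlongrightarrow> D j \<theta>) (at 0)"
    by (simp add: isCont_def)
  have \<sigma>lim: "(\<sigma> \<longlongrightarrow> A) (at 0)"
    using has_vector_derivative_continuous[OF \<sigma>] by (simp add: isCont_def \<sigma>0)
  have Llim: "((\<lambda>t. L (\<theta> + t *\<^sub>R axis i 1)) \<longlongrightarrow> double_op_sum (powr_divdiff p) A A (D j \<theta>)) (at 0)"
    unfolding L_def using \<sigma>lim
    by (intro tendsto_double_op_sum continuous_on_powr_divdiff A herm Dlim) (simp_all add: \<sigma>_def)
  \<comment> \<open>Continuity of the denominator is read off from its differentiability.\<close>
  have "((\<lambda>t. trace (op_powr (renyi_core \<alpha> z A (\<sigma> t)) z)) has_vector_derivative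
      z *\<^sub>R trace (op_powr (renyi_core \<alpha> z A (\<sigma> 0)) (z - 1) **
        (op_powr (\<sigma> 0) ((1 - \<alpha>) / (2 * z)) ** op_powr A (\<alpha> / z) **
          double_op_sum (powr_divdiff ((1 - \<alpha>) / (2 * z))) (\<sigma> 0) (\<sigma> 0) (D i \<theta>)
        + double_op_sum (powr_divdiff ((1 - \<alpha>) / (2 * z))) (\<sigma> 0) (\<sigma> 0) (D i \<theta>) **
          op_powr A (\<alpha> / z) ** op_powr (\<sigma> 0) ((1 - \<alpha>) / (2 * z))))) (at 0)"
    by (intro has_vector_derivative_trace_op_powr has_vector_derivative_renyi_core \<sigma> \<sigma>_pos
        pos_def_renyi_core A)
  from has_vector_derivative_continuous[OF this]
  have "((\<lambda>t. trace (op_powr (renyi_core \<alpha> z A (\<sigma> t)) z)) \<longlongrightarrow>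
      trace (op_powr (renyi_core \<alpha> z A A) z)) (at 0)"
    by (simp add: isCont_def \<sigma>0)
  \<comment> \<open>At \<open>A\<close> the core is the power with exponent \<open>1 / z\<close>, so
    the denominator tends to the trace of a state.\<close>
  also have "op_powr (renyi_core \<alpha> z A A) z = A"
    using A assms(5) by (simp add: renyi_core_same op_powr_op_powr op_powr_one)
  also have "trace A = 1"
    using assms(1) by (simp add: A_def state_def)
  finally have Qlim: "((\<lambda>t. Q (\<theta> + t *\<^sub>R axis i 1)) \<longlongrightarrow> 1) (at 0)"
    unfolding Q_def \<sigma>_def using tendsto_Re by fastforce
  have "partial_deriv i (partial_deriv j F) 0 = z / (\<alpha> - 1) *
      Re (trace (double_op_sum (renyi_weight_symbol \<alpha> z) A A (D i \<theta>) **
        double_op_sum (powr_divdiff p) A A (D j \<theta>)))"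
    unfolding partial_deriv_def[of i] first
    using has_vector_derivative_trace_mult_divide[OF W W0 Llim Qlim, of "z / (\<alpha> - 1)"]
    by (intro vector_derivative_at) (simp add: \<sigma>_def)
  then have "complex_of_real (info_matrix \<alpha> z \<rho> \<theta> $ i $ j) =
      complex_of_real (1 / \<alpha> * (z / (\<alpha> - 1))) *
      complex_of_real (Re (trace (double_op_sum (renyi_weight_symbol \<alpha> z) A A (D i \<theta>) **
        double_op_sum (powr_divdiff p) A A (D j \<theta>))))"
    by (simp add: info_matrix_def F_def A_def)
  \<comment> \<open>Both symbols are symmetric and both partial derivatives Hermitian, so the trace
    is real.\<close>
  also have "\<dots> = complex_of_real (1 / \<alpha> * (z / (\<alpha> - 1))) *
      trace (double_op_sum (renyi_weight_symbol \<alpha> z) A A (D i \<theta>) **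
        double_op_sum (powr_divdiff p) A A (D j \<theta>))"
    by (subst trace_mult_hermitian_real)
      (intro hermitian_double_op_sum A hD renyi_weight_symbol_commute powr_divdiff_commute refl)+
  also have "\<dots> = (\<Sum>k\<in>eigenvalues A. \<Sum>l\<in>eigenvalues A.
      complex_of_real (1 / \<alpha> * (z / (\<alpha> - 1)) *
        (renyi_weight_symbol \<alpha> z (k, l) * powr_divdiff p (l, k))) *
      trace (eigenprojection A k ** D i \<theta> ** eigenprojection A l ** D j \<theta>))"
    unfolding trace_double_op_sum_mult[OF A(2)] sum_distrib_left of_real_mult mult.assoc ..
  also have "\<dots> = (\<Sum>k\<in>eigenvalues A. \<Sum>l\<in>eigenvalues A. complex_of_real (zeta_fun \<alpha> z k l) *
      trace (eigenprojection A k ** D i \<theta> ** eigenprojection A l ** D j \<theta>))"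
  proof (intro sum.cong refl)
    fix k l assume "k \<in> eigenvalues A" "l \<in> eigenvalues A"
    then have "0 < k" "0 < l" using pos_def_eigenvalue_pos A by blast+
    from zeta_fun_eq_symbol[OF this assms(5) \<alpha>]
    have "1 / \<alpha> * (z / (\<alpha> - 1)) * (renyi_weight_symbol \<alpha> z (k, l) * powr_divdiff p (l, k))
        = zeta_fun \<alpha> z k l"
      by (simp add: p_def)
    then show "complex_of_real (1 / \<alpha> * (z / (\<alpha> - 1)) *
        (renyi_weight_symbol \<alpha> z (k, l) * powr_divdiff p (l, k))) *
      trace (eigenprojection A k ** D i \<theta> ** eigenprojection A l ** D j \<theta>) =
      complex_of_real (zeta_fun \<alpha> z k l) *
      trace (eigenprojection A k ** D i \<theta> ** eigenprojection A l ** D j \<theta>)"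
      by (simp only:)
  qed
  finally show ?thesis by (simp only: A_def pd)
qed

end
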